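(* Let $m_1,m_2\in\mathbb{N}$ and suppose $v\in\big[L^1((0,R))\big]^{m_1\times m_2}$ for all $R>0$. Let $\ell\ge 0$ and partition $u_0(\ell,z)=\{u_{0,jk}(\ell,z)\}_{j,k=1}^2$ into blocks, $u_{0,11}$ being $m_1\times m_1$ and $u_{0,22}$ being $m_2\times m_2$. Then for $z\in\mathbb{C}_+$ the matrix $u_{0,11}(\ell,z)+u_{0,12}(\ell,z)\varphi_0(z)$ is invertible and the Weyl–Titchmarsh functions $\varphi_\ell$ and $\varphi_0$ on $[\ell,\infty)$ and $[0,\infty)$ satisfy \[ \varphi_\ell(z)=\big(u_{0,21}(\ell,z)+u_{0,22}(\ell,z)\varphi_0(z)\big)\big(u_{0,11}(\ell,z)+u_{0,12}(\ell,z)\varphi_0(z)\big)^{-1}. \]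
   Context: Dirac-type system $y'(x,z)=i(zJ+JV(x))y(x,z)$, $x\ge0$, $m=m_1+m_2$, $J=\begin{bmatrix}I_{m_1}&0\\0&-I_{m_2}\end{bmatrix}$, $V=\begin{bmatrix}0_{m_1}&v\\ v^*&0_{m_2}\end{bmatrix}$. For $\ell\ge 0$, $u_\ell(x,z)$ is the $m\times m$ fundamental solution with $u_\ell(\ell,z)=I_m$. The Weyl–Titchmarsh function $\varphi_\ell(z)$ on $[\ell,\infty)$ is the (unique, existing) $m_2\times m_1$ matrix function holomorphic in $\mathbb{C}_+$ such that $u_\ell(\cdot,z)\begin{bmatrix}I_{m_1}\\ \varphi_\ell(z)\end{bmatrix}$ has entries in $L^2((\ell,\infty))$. *)

theory Defs
  imports "HOL-Analysis.Analysis"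
begin

text \<open>Index types: 'a has m1 elements, 'b has m2 elements, m = m1 + m2 is the
  sum type 'a + 'b.  Inl indexes the first m1 coordinates, Inr the last m2.\<close>

definition Jmat :: "complex^('a::finite + 'b::finite)^('a + 'b)" where
  "Jmat = (\<chi> i j. if i = j then (case i of Inl _ \<Rightarrow> 1 | Inr _ \<Rightarrow> -1) else 0)"

text \<open>Potential V(x) = [[0, v(x)], [v(x)^*, 0]] for x \<ge> 0; extended by 0 to x < 0
  (only so that the fundamental solution is uniquely determined on all of the real line;
  its values on [0,\<infinity>) are unaffected).\<close>
definition Vpot :: "(real \<Rightarrow> complex^'b::finite^'a::finite) \<Rightarrow> real \<Rightarrow> complex^('a + 'b)^('a + 'b)" where
  "Vpot v x = (\<chi> i j. if x < 0 then 0 else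
     (case (i, j) of (Inl a, Inr b) \<Rightarrow> v x $ a $ b
                   | (Inr b, Inl a) \<Rightarrow> cnj (v x $ a $ b)
                   | _ \<Rightarrow> 0))"

definition dirac_coef :: "(real \<Rightarrow> complex^'b::finite^'a::finite) \<Rightarrow> complex \<Rightarrow> real \<Rightarrow> complex^('a + 'b)^('a + 'b)" where
  "dirac_coef v z x = (\<chi> i j. \<i> * (z * Jmat $ i $ j + (Jmat ** Vpot v x) $ i $ j))"

definition sint :: "real \<Rightarrow> real \<Rightarrow> (real \<Rightarrow> 'c::euclidean_space) \<Rightarrow> 'c" where
  "sint a b f = (if a \<le> b then integral {a..b} f else - integral {b..a} f)"

text \<open>u solves the system with u(l) = I (absolutely continuous solution, i.e. the
  integral equation u(x) = I + \<integral>_l^x i(zJ + JV(t)) u(t) dt).\<close>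
definition is_fund_sol :: "(real \<Rightarrow> complex^'b::finite^'a::finite) \<Rightarrow> real \<Rightarrow> complex \<Rightarrow> (real \<Rightarrow> complex^('a + 'b)^('a + 'b)) \<Rightarrow> bool" where
  "is_fund_sol v l z u \<longleftrightarrow>
     (\<forall>a b. (\<lambda>t. dirac_coef v z t ** u t) integrable_on {a..b}) \<and>
     (\<forall>x. u x = mat 1 + sint l x (\<lambda>t. dirac_coef v z t ** u t))"

definition fund_sol :: "(real \<Rightarrow> complex^'b::finite^'a::finite) \<Rightarrow> real \<Rightarrow> complex \<Rightarrow> real \<Rightarrow> complex^('a + 'b)^('a + 'b)" where
  "fund_sol v l z = (THE u. is_fund_sol v l z u)"

definition stack_id :: "complex^'a::finite^'b::finite \<Rightarrow> complex^'a^('a + 'b)" where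
  "stack_id \<phi> = (\<chi> i k. case i of Inl a \<Rightarrow> (if a = k then 1 else 0) | Inr b \<Rightarrow> \<phi> $ b $ k)"

text \<open>Weyl--Titchmarsh function on [l,\<infinity>): the m2 \<times> m1 matrix function holomorphic in
  the upper half-plane with u_l(\<cdot>,z)[I;\<phi>(z)] having entries in L^2((l,\<infinity>)).
  Outside the upper half-plane it is normalised to 0 so that it is uniquely determined.\<close>
definition is_WT :: "(real \<Rightarrow> complex^'b::finite^'a::finite) \<Rightarrow> real \<Rightarrow> (complex \<Rightarrow> complex^'a^'b) \<Rightarrow> bool" where
  "is_WT v l \<phi> \<longleftrightarrow>
     (\<forall>b k. (\<lambda>z. \<phi> z $ b $ k) holomorphic_on {z. Im z > 0}) \<and>
     (\<forall>z. Im z > 0 \<longrightarrow> (\<forall>i k.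
        (\<lambda>x. (fund_sol v l z x ** stack_id (\<phi> z)) $ i $ k) \<in> borel_measurable (lebesgue_on {l<..}) \<and>
        (\<lambda>x. (cmod ((fund_sol v l z x ** stack_id (\<phi> z)) $ i $ k))\<^sup>2) integrable_on {l<..})) \<and>
     (\<forall>z. Im z \<le> 0 \<longrightarrow> \<phi> z = 0)"

definition WT :: "(real \<Rightarrow> complex^'b::finite^'a::finite) \<Rightarrow> real \<Rightarrow> complex \<Rightarrow> complex^'a^'b" where
  "WT v l = (THE \<phi>. is_WT v l \<phi>)"

definition blk11 :: "complex^('a::finite + 'b::finite)^('a + 'b) \<Rightarrow> complex^'a^'a" where
  "blk11 M = (\<chi> i j. M $ Inl i $ Inl j)"
definition blk12 :: "complex^('a::finite + 'b::finite)^('a + 'b) \<Rightarrow> complex^'b^'a" where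
  "blk12 M = (\<chi> i j. M $ Inl i $ Inr j)"
definition blk21 :: "complex^('a::finite + 'b::finite)^('a + 'b) \<Rightarrow> complex^'a^'b" where
  "blk21 M = (\<chi> i j. M $ Inr i $ Inl j)"
definition blk22 :: "complex^('a::finite + 'b::finite)^('a + 'b) \<Rightarrow> complex^'b^'b" where
  "blk22 M = (\<chi> i j. M $ Inr i $ Inr j)"

end

(* The form kform y y = |y_1|^2 - |y_2|^2 satisfies d/dx kform y y = -2 Im z |y|^2 along solutions, so
for Im z > 0 it decreases, and a solution on which it becomes negative stays bounded away from 0 and
is not in L^2.  Hence it is nonnegative on L^2 solutions.  At x = l this makes the matrix phi with
u_l [I; phi] in L^2 unique for each z, and at an intermediate point it makes u_11 + u_12 phi_0
injective.  Since u_0(x) = u_l(x) u_0(l), the asserted quotient yields an L^2 solution on [l, oo), and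
pointwise uniqueness gives the formula.

Existence of the Weyl function: for R >= l let phi_R be the matrix whose solution has vanishing lower
block at R.  It is holomorphic and contractive, and kform >= 0 on [l, R].  Limit points as R tends to
infinity satisfy kform >= 0 everywhere, hence give L^2 solutions; by uniqueness the limit is the same
along all subsequences, so it is holomorphic by Montel's theorem. *)

theory Submission
  imports Defs "HOL-Complex_Analysis.Complex_Analysis"
begin

text \<open>Since \<open>v\<close> is only locally integrable, solutions have no classical
  derivative and the definitions speak of integrals alone. Every differential statement is therefore
  one about increments, and the chief piece of calculus required is a product rule in that form.
  \<open>fund_sol\<close> and \<open>WT\<close> are descriptions by \<open>THE\<close>, so nothing
  is known about them before existence and uniqueness are proved. For \<open>fund_sol\<close> one
  series serves twice: its sum solves the system, and its terms are polynomials in z, which yields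
  holomorphy. For \<open>WT\<close> the obstacle is that its two properties come from different
  limits. Montel's theorem treats one matrix entry at a time, with a subsequence depending on that
  entry, whereas a square-integrable solution arises from convergence of the whole matrix at one
  fixed z. Uniqueness at that z identifies the two limits.\<close>

section \<open>Absolutely continuous functions\<close>

text \<open>Absolute continuity with a.e. derivative \<open>f\<close>, stated through increments so that no
  differentiation theorem is needed.\<close>
definition ac_deriv :: "(real \<Rightarrow> 'e::euclidean_space) \<Rightarrow> (real \<Rightarrow> 'e) \<Rightarrow> bool" where
  "ac_deriv F f \<longleftrightarrow> (\<forall>s t. f absolutely_integrable_on {s..t}) \<and>
     (\<forall>s t. s \<le> t \<longrightarrow> F t - F s = integral {s..t} f)"

lemma ac_derivD:
  assumes "ac_deriv F f"
  shows ac_deriv_absint: "f absolutely_integrable_on {s..t}"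
    and ac_deriv_integrable: "f integrable_on {s..t}"
    and ac_deriv_incr: "s \<le> t \<Longrightarrow> F t - F s = integral {s..t} f"
  using assms by (auto simp: ac_deriv_def set_lebesgue_integral_eq_integral(1))

lemma ac_deriv_continuous:
  assumes "ac_deriv F f"
  shows "continuous_on S F"
proof -
  have "isCont F x" for x
  proof -
    have "continuous_on {x-1..x+1} (\<lambda>t. F (x-1) + integral {x-1..t} f)"
      by (intro continuous_intros indefinite_integral_continuous_1 ac_deriv_integrable[OF assms])
    then have "continuous_on {x-1..x+1} F"
      by (rule continuous_on_eq) (simp flip: ac_deriv_incr[OF assms])
    then show ?thesis
      by (rule continuous_on_interior) auto
  qed
  then show ?thesis
    by (simp add: continuous_at_imp_continuous_on)
qed

lemma integral_split:
  fixes f :: "real \<Rightarrow> 'e::euclidean_space"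
  assumes "\<And>s t. f integrable_on {s..t}" "a \<le> b" "b \<le> c"
  shows "integral {a..c} f = integral {a..b} f + integral {b..c} f"
  using Henstock_Kurzweil_Integration.integral_combine[of a b c f] assms by simp

lemma sint_diff:
  fixes f :: "real \<Rightarrow> 'e::euclidean_space"
  assumes "\<And>s t. f integrable_on {s..t}" "s \<le> t"
  shows "sint l t f - sint l s f = integral {s..t} f"
  using integral_split[of f l s t] integral_split[of f s l t] integral_split[of f s t l] assms
  by (auto simp: sint_def algebra_simps)

lemma ac_deriv_sint:
  assumes "\<And>s t. f absolutely_integrable_on {s..t}"
  shows "ac_deriv (\<lambda>x. c + sint l x f) f"
proof -
  have i: "f integrable_on {s..t}" for s t
    using assms by (simp add: set_lebesgue_integral_eq_integral(1))
  have "sint l t f - sint l s f = integral {s..t} f" if "s \<le> t" for s t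
    using that by (rule sint_diff[OF i])
  then show ?thesis
    using assms by (auto simp: ac_deriv_def)
qed

lemma sint_self [simp]: "sint l l f = 0"
  by (simp add: sint_def)

lemma ac_deriv_eq_sint:
  assumes "ac_deriv F f"
  shows "F x = F l + sint l x f"
  using ac_deriv_incr[OF assms, of l x] ac_deriv_incr[OF assms, of x l]
  by (auto simp: sint_def algebra_simps)

text \<open>Both sides are additive over adjacent intervals, so an error that is locally small relative to
  \<open>\<mu>\<close> is small globally; letting \<open>e\<close> tend to 0 removes it.\<close>
lemma ac_deriv_approx:
  fixes F h :: "real \<Rightarrow> 'e::euclidean_space" and \<mu> :: "real \<Rightarrow> real"
  assumes h: "\<And>s t. h absolutely_integrable_on {s..t}"
    and \<mu>: "\<And>s t. \<mu> integrable_on {s..t}"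
    and loc: "\<And>x e. e > 0 \<Longrightarrow> \<exists>d>0. \<forall>s t. s \<le> x \<and> x \<le> t \<and> t - s < d \<longrightarrow>
        norm (F t - F s - integral {s..t} h) \<le> e * integral {s..t} \<mu>"
  shows "ac_deriv F h"
proof -
  have i: "h integrable_on {s..t}" for s t
    using h by (simp add: set_lebesgue_integral_eq_integral(1))
  have "F t - F s = integral {s..t} h" if "s \<le> t" for s t
  proof -
    have le: "norm (F t - F s - integral {s..t} h) \<le> e * integral {s..t} \<mu>" if "e > 0" for e
      using \<open>s \<le> t\<close>
    proof (induction rule: Bolzano)
      case (trans a b c)
      have "F c - F a - integral {a..c} h =
          (F b - F a - integral {a..b} h) + (F c - F b - integral {b..c} h)"
        using integral_split[of h a b c] i trans by (simp add: algebra_simps)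
      then have "norm (F c - F a - integral {a..c} h) \<le>
          norm (F b - F a - integral {a..b} h) + norm (F c - F b - integral {b..c} h)"
        by (metis norm_triangle_ineq)
      also have "\<dots> \<le> e * integral {a..b} \<mu> + e * integral {b..c} \<mu>"
        using trans by linarith
      also have "\<dots> = e * integral {a..c} \<mu>"
        using integral_split[of \<mu> a b c] \<mu> trans by (simp add: algebra_simps)
      finally show ?case .
    qed (use loc that in blast)
    have "norm (F t - F s - integral {s..t} h) \<le> 0"
    proof (rule field_le_epsilon)
      fix e :: real assume "e > 0"
      \<comment> \<open>The sign of this integral is unknown, and it may be 0; dividing by
        \<open>\<bar>?I\<bar> + 1\<close> is safe in every case.\<close>
      let ?I = "integral {s..t} \<mu>"
      have "e / (\<bar>?I\<bar> + 1) > 0" using \<open>e > 0\<close> by auto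
      from le[OF this] have "norm (F t - F s - integral {s..t} h) \<le> e / (\<bar>?I\<bar> + 1) * ?I" .
      also have "\<dots> \<le> e / (\<bar>?I\<bar> + 1) * (\<bar>?I\<bar> + 1)"
        using \<open>e > 0\<close> by (intro mult_left_mono) auto
      also have "\<dots> = e" by (simp add: add_nonneg_eq_0_iff)
      finally show "norm (F t - F s - integral {s..t} h) \<le> 0 + e" by simp
    qed
    then show ?thesis by simp
  qed
  then show ?thesis using h by (auto simp: ac_deriv_def)
qed

text \<open>On a compact interval the continuous factor is measurable and bounded, so the product
  inherits integrability. This is how \<open>A t ** u t\<close> becomes absolutely integrable for
  integrable \<open>A\<close> and continuous \<open>u\<close>.\<close>

lemma absint_continuous_bilinear:
  fixes h :: "'a::euclidean_space \<Rightarrow> 'b::euclidean_space \<Rightarrow> 'c::euclidean_space"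
  assumes "bounded_bilinear h" "continuous_on UNIV f" "g absolutely_integrable_on {s..t::real}"
  shows "(\<lambda>x. h (f x) (g x)) absolutely_integrable_on {s..t}"
proof (rule absolutely_integrable_bounded_measurable_product[where h = h and f = f and g = g])
  show "bilinear h" using assms(1) by (simp add: bilinear_conv_bounded_bilinear)
  have c: "continuous_on {s..t} f" using assms(2) continuous_on_subset by blast
  then show "f \<in> borel_measurable (lebesgue_on {s..t})"
    by (intro continuous_imp_measurable_on_sets_lebesgue) auto
  show "bounded (f ` {s..t})"
    using c compact_continuous_image compact_imp_bounded by blast
qed (use assms in auto)

lemma ac_deriv_mult:
  fixes P :: "'a::euclidean_space \<Rightarrow> 'b::euclidean_space \<Rightarrow> 'c::euclidean_space"
  assumes P: "bounded_bilinear P" and f: "ac_deriv f f'" and g: "ac_deriv g g'"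
  shows "ac_deriv (\<lambda>x. P (f x) (g x)) (\<lambda>x. P (f' x) (g x) + P (f x) (g' x))"
proof -
  interpret P: bounded_bilinear P by (rule P)
  obtain K where K: "K > 0" "\<And>a b. norm (P a b) \<le> norm a * norm b * K"
    using P.pos_bounded by blast
  note cf = ac_deriv_continuous[OF f] and cg = ac_deriv_continuous[OF g]
  note af = ac_deriv_absint[OF f] and ag = ac_deriv_absint[OF g]
  have h1: "(\<lambda>x. P (f' x) (g x)) absolutely_integrable_on {s..t}" for s t
    using absint_continuous_bilinear[OF P.flip cg af] .
  have h2: "(\<lambda>x. P (f x) (g' x)) absolutely_integrable_on {s..t}" for s t
    using absint_continuous_bilinear[OF P cf ag] .
  let ?\<mu> = "\<lambda>x. norm (f' x) + norm (g' x)"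
  have \<mu>: "?\<mu> integrable_on {s..t}" for s t
    using af ag by (intro integrable_add) (auto simp: absolutely_integrable_on_def)
  have i': "f' integrable_on {s..t}" "g' integrable_on {s..t}" for s t
    using ac_deriv_integrable f g by blast+
  show ?thesis
  proof (rule ac_deriv_approx[where \<mu> = ?\<mu>])
    show "(\<lambda>x. P (f' x) (g x) + P (f x) (g' x)) absolutely_integrable_on {s..t}" for s t
      using h1 h2 by (rule set_integral_add)
    fix x e :: real assume e: "e > 0"
    \<comment> \<open>Two points of the interval are each this close to the value at x, so they
      differ by at most \<open>e / K\<close>; the constant K of the product cancels the
      denominator.\<close>
    have "e / (2*K) > 0" using e K by simp
    moreover have "isCont f x" "isCont g x"
      using cf cg continuous_on_eq_continuous_at open_UNIV by blast+
    ultimately obtain d1 d2 where d: "d1 > 0" "d2 > 0"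
        "\<And>y. \<bar>y - x\<bar> < d1 \<Longrightarrow> norm (f y - f x) < e / (2*K)"
        "\<And>y. \<bar>y - x\<bar> < d2 \<Longrightarrow> norm (g y - g x) < e / (2*K)"
      unfolding continuous_at_eps_delta dist_norm real_norm_def by metis
    show "\<exists>d>0. \<forall>s t. s \<le> x \<and> x \<le> t \<and> t - s < d \<longrightarrow>
        norm (P (f t) (g t) - P (f s) (g s) - integral {s..t} (\<lambda>x. P (f' x) (g x) + P (f x) (g' x)))
         \<le> e * integral {s..t} ?\<mu>"
    proof (intro exI[of _ "min d1 d2"] conjI allI impI)
      fix s t assume st: "s \<le> x \<and> x \<le> t \<and> t - s < min d1 d2"
      have close: "norm (f y - f w) \<le> e / K" "norm (g y - g w) \<le> e / K" 
        if "y \<in> {s..t}" "w \<in> {s..t}" for y w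
      proof -
        have "norm (f y - f w) \<le> norm (f y - f x) + norm (f w - f x)"
          using norm_triangle_ineq4[of "f y - f x" "f w - f x"] by simp
        also have "\<dots> \<le> e/(2*K) + e/(2*K)"
          using that st d(3)[of y] d(3)[of w] by (intro add_mono less_imp_le) auto
        finally show "norm (f y - f w) \<le> e / K" using K by (simp add: field_simps)
        have "norm (g y - g w) \<le> norm (g y - g x) + norm (g w - g x)"
          using norm_triangle_ineq4[of "g y - g x" "g w - g x"] by simp
        also have "\<dots> \<le> e/(2*K) + e/(2*K)"
          using that st d(4)[of y] d(4)[of w] by (intro add_mono less_imp_le) auto
        finally show "norm (g y - g w) \<le> e / K" using K by (simp add: field_simps)
      qed
      have e1: "integral {s..t} (\<lambda>x. P (f' x) (g t)) = P (f t - f s) (g t)"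
        using integral_linear[OF i'(1)[of s t] P.bounded_linear_left[of "g t"]] ac_deriv_incr[OF f, of s t] st
        by (simp add: o_def)
      have e2: "integral {s..t} (\<lambda>x. P (f s) (g' x)) = P (f s) (g t - g s)"
        using integral_linear[OF i'(2)[of s t] P.bounded_linear_right[of "f s"]] ac_deriv_incr[OF g, of s t] st
        by (simp add: o_def)
      have I1: "(\<lambda>x. P (f' x) (g x)) integrable_on {s..t}" "(\<lambda>x. P (f x) (g' x)) integrable_on {s..t}"
        using h1 h2 by (simp_all add: set_lebesgue_integral_eq_integral(1))
      have I2: "(\<lambda>x. P (f' x) (g t)) integrable_on {s..t}" "(\<lambda>x. P (f s) (g' x)) integrable_on {s..t}"
        using integrable_linear[OF i'(1)[of s t] P.bounded_linear_left[of "g t"]]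
              integrable_linear[OF i'(2)[of s t] P.bounded_linear_right[of "f s"]] by (simp_all add: o_def)
      have "P (f t) (g t) - P (f s) (g s) = P (f t - f s) (g t) + P (f s) (g t - g s)"
        by (simp add: P.diff_left P.diff_right)
      also have "\<dots> = integral {s..t} (\<lambda>x. P (f' x) (g t) + P (f s) (g' x))"
        using I2 by (simp add: Henstock_Kurzweil_Integration.integral_add e1 e2)
      finally have "P (f t) (g t) - P (f s) (g s) - integral {s..t} (\<lambda>x. P (f' x) (g x) + P (f x) (g' x))
         = integral {s..t} (\<lambda>x. (P (f' x) (g t) + P (f s) (g' x)) - (P (f' x) (g x) + P (f x) (g' x)))"
        using I1 I2 by (simp add: Henstock_Kurzweil_Integration.integral_diff integrable_add)
      also have "norm \<dots> \<le> integral {s..t} (\<lambda>x. e * ?\<mu> x)"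
      proof (rule integral_norm_bound_integral)
        show "(\<lambda>x. (P (f' x) (g t) + P (f s) (g' x)) - (P (f' x) (g x) + P (f x) (g' x))) integrable_on {s..t}"
          using I1 I2 by (intro integrable_diff integrable_add)
        show "(\<lambda>x. e * ?\<mu> x) integrable_on {s..t}"
          by (rule integrable_on_mult_right[OF \<mu>])
        fix y assume y: "y \<in> {s..t}"
        have "(P (f' y) (g t) + P (f s) (g' y)) - (P (f' y) (g y) + P (f y) (g' y))
            = P (f' y) (g t - g y) + P (f s - f y) (g' y)"
          by (simp add: P.diff_left P.diff_right)
        also have "norm \<dots> \<le> norm (f' y) * norm (g t - g y) * K + norm (f s - f y) * norm (g' y) * K"
          by (rule order.trans[OF norm_triangle_ineq add_mono[OF K(2) K(2)]])
        also have "\<dots> \<le> norm (f' y) * (e / K) * K + (e / K) * norm (g' y) * K"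
          using y st K(1) by (intro add_mono mult_right_mono mult_left_mono close) auto
        also have "\<dots> = e * ?\<mu> y"
          using K(1) by (simp add: field_simps)
        finally show "norm ((P (f' y) (g t) + P (f s) (g' y)) - (P (f' y) (g y) + P (f y) (g' y))) \<le> e * ?\<mu> y" .
      qed
      also have "\<dots> = e * integral {s..t} ?\<mu>"
        by simp
      finally show "norm (P (f t) (g t) - P (f s) (g s) - integral {s..t} (\<lambda>x. P (f' x) (g x) + P (f x) (g' x)))
         \<le> e * integral {s..t} ?\<mu>" .
    qed (use d in auto)
  qed (rule \<mu>)
qed

lemma ac_deriv_linear:
  assumes "bounded_linear L" "ac_deriv f f'"
  shows "ac_deriv (\<lambda>x. L (f x)) (\<lambda>x. L (f' x))"
proof -
  interpret L: bounded_linear L by (rule assms)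
  have "(\<lambda>x. L (f' x)) absolutely_integrable_on {s..t}" for s t
    using absolutely_integrable_linear[OF ac_deriv_absint[OF assms(2)] assms(1)] by (simp add: o_def)
  moreover have "L (f t) - L (f s) = integral {s..t} (\<lambda>x. L (f' x))" if "s \<le> t" for s t
    using integral_linear[OF ac_deriv_integrable[OF assms(2), of s t] assms(1)]
      ac_deriv_incr[OF assms(2) that] by (simp add: o_def flip: L.diff)
  ultimately show ?thesis by (auto simp: ac_deriv_def)
qed

lemma ac_deriv_add:
  assumes "ac_deriv f f'" "ac_deriv g g'"
  shows "ac_deriv (\<lambda>x. f x + g x) (\<lambda>x. f' x + g' x)"
  unfolding ac_deriv_def
  using assms[THEN ac_deriv_absint] assms[THEN ac_deriv_integrable] assms[THEN ac_deriv_incr, symmetric]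
  by (auto simp: Henstock_Kurzweil_Integration.integral_add intro!: set_integral_add)

lemma ac_deriv_diff:
  assumes "ac_deriv f f'" "ac_deriv g g'"
  shows "ac_deriv (\<lambda>x. f x - g x) (\<lambda>x. f' x - g' x)"
  using ac_deriv_add[OF assms(1) ac_deriv_linear[OF bounded_linear_minus[OF bounded_linear_ident] assms(2)]]
  by simp

lemma ac_deriv_power:
  fixes \<alpha> a :: "real \<Rightarrow> real"
  assumes "ac_deriv \<alpha> a"
  shows "ac_deriv (\<lambda>x. \<alpha> x ^ Suc n) (\<lambda>x. real (Suc n) * a x * \<alpha> x ^ n)"
proof (induction n)
  case 0
  then show ?case using assms by simp
next
  case (Suc n)
  have eq: "real (Suc n) * a x * \<alpha> x ^ n * \<alpha> x + \<alpha> x ^ Suc n * a x = real (Suc (Suc n)) * a x * \<alpha> x ^ Suc n" for x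
    by (simp add: algebra_simps)
  have eq2: "\<alpha> x ^ Suc n * \<alpha> x = \<alpha> x ^ Suc (Suc n)" for x by simp
  from ac_deriv_mult[OF bounded_bilinear_mult Suc assms] show ?case
    unfolding eq eq2 .
qed

section \<open>Linear systems with integrable coefficients\<close>

lemma bounded_bilinear_matrix_mult:
  "bounded_bilinear ((**) :: complex^'n^'m \<Rightarrow> complex^'k^'n \<Rightarrow> complex^'k^'m)"
proof -
  have "bilinear ((**) :: complex^'n^'m \<Rightarrow> complex^'k^'n \<Rightarrow> complex^'k^'m)"
    unfolding bilinear_def
    by (intro conjI allI linearI)
      (simp_all add: vec_eq_iff matrix_matrix_mult_def algebra_simps sum.distrib scaleR_right.sum)
  then show ?thesis by (simp add: bilinear_conv_bounded_bilinear)
qed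

lemma bounded_bilinear_matrix_vector_mult:
  "bounded_bilinear ((*v) :: complex^'n^'m \<Rightarrow> complex^'n \<Rightarrow> complex^'m)"
proof -
  have "bilinear ((*v) :: complex^'n^'m \<Rightarrow> complex^'n \<Rightarrow> complex^'m)"
    unfolding bilinear_def
    by (intro conjI allI linearI)
      (simp_all add: vec_eq_iff matrix_vector_mult_def algebra_simps sum.distrib scaleR_right.sum)
  then show ?thesis by (simp add: bilinear_conv_bounded_bilinear)
qed

lemmas ac_deriv_rmult =
  ac_deriv_linear[OF bounded_bilinear.bounded_linear_left[OF bounded_bilinear_matrix_mult]]
lemmas ac_deriv_rmult_vec =
  ac_deriv_linear[OF bounded_bilinear.bounded_linear_left[OF bounded_bilinear_matrix_vector_mult]]

lemma ac_deriv_norm_le: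
  assumes F: "ac_deriv F f" and g: "g integrable_on {p..q}"
    and le: "\<And>t. t \<in> {p..q} \<Longrightarrow> norm (f t) \<le> g t" and "p \<le> q"
  shows "norm (F q - F p) \<le> integral {p..q} g"
  using integral_norm_bound_integral[OF ac_deriv_integrable[OF F] g le] ac_deriv_incr[OF F \<open>p \<le> q\<close>]
  by simp

lemma absint_norm:
  fixes A :: "real \<Rightarrow> 'a::euclidean_space"
  assumes "\<And>s t. A absolutely_integrable_on {s..t::real}"
  shows "(\<lambda>x. norm (A x)) absolutely_integrable_on {s..t}"
  using absolutely_integrable_norm[OF assms] by (simp add: o_def)

text \<open>A local Gronwall argument: near each point the integral of \<open>norm A\<close> is so
  small that a solution with a zero there has its maximum bounded by half of itself.\<close>

lemma ac_linear_zero: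
  fixes P :: "'a::euclidean_space \<Rightarrow> 'b::euclidean_space \<Rightarrow> 'b"
  assumes P: "bounded_bilinear P" and A: "\<And>s t. A absolutely_integrable_on {s..t}"
    and D: "ac_deriv D (\<lambda>t. P (A t) (D t))" and "D c = 0"
  shows "D x = 0"
proof -
  obtain K where K: "K > 0" "\<And>a b. norm (P a b) \<le> norm a * norm b * K"
    using bounded_bilinear.pos_bounded[OF P] by blast
  define \<alpha> where "\<alpha> x = 0 + sint 0 x (\<lambda>t. norm (A t))" for x
  have \<alpha>: "ac_deriv \<alpha> (\<lambda>t. norm (A t))"
    unfolding \<alpha>_def by (rule ac_deriv_sint[OF absint_norm[OF A]])
  \<comment> \<open>In the form "one zero forces all zeros" the property is additive over adjacent
    intervals, through their common endpoint, and it treats both directions from c alike.\<close>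
  have "(\<exists>r\<in>{min c x..max c x}. D r = 0) \<longrightarrow> (\<forall>r\<in>{min c x..max c x}. D r = 0)" (is "?Q (min c x) (max c x)")
  proof -
    have "min c x \<le> max c x" by simp
    then show "?Q (min c x) (max c x)"
    proof (induction rule: Bolzano)
      case (trans a b c)
      show ?case
      proof (intro impI)
        assume "\<exists>r\<in>{a..c}. D r = 0"
        then obtain r where r: "r \<in> {a..b} \<or> r \<in> {b..c}" "D r = 0" by fastforce
        have "b \<in> {a..b}" "b \<in> {b..c}" using trans by auto
        then have "D b = 0" using r trans by blast
        then have "\<forall>r\<in>{a..b}. D r = 0" "\<forall>r\<in>{b..c}. D r = 0"
          using trans \<open>b \<in> {a..b}\<close> \<open>b \<in> {b..c}\<close> by blast+
        then show "\<forall>r\<in>{a..c}. D r = 0"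
          by (metis atLeastAtMost_iff linear)
      qed
    next
      case (local y)
      have "isCont \<alpha> y"
        using ac_deriv_continuous[OF \<alpha>] continuous_on_eq_continuous_at open_UNIV by blast
      \<comment> \<open>Two points near y give an increment of \<alpha> of at most
        \<open>1 / (2*K)\<close>; together with the factor K this is the contraction constant
        1/2.\<close>
      moreover have "1 / (4*K) > 0" using K by simp
      ultimately obtain d where d: "d > 0" "\<And>w. \<bar>w - y\<bar> < d \<Longrightarrow> \<bar>\<alpha> w - \<alpha> y\<bar> < 1 / (4*K)"
        unfolding continuous_at_eps_delta dist_norm real_norm_def by metis
      show ?case
      proof (intro exI[of _ d] conjI allI impI ballI d(1))
        fix s t q assume st: "s \<le> y \<and> y \<le> t \<and> t - s < d" and ex: "\<exists>r\<in>{s..t}. D r = 0" and q: "q \<in> {s..t}"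
        from ex obtain r where r: "r \<in> {s..t}" "D r = 0" by blast
        have "continuous_on {s..t} (\<lambda>t. norm (D t))"
          by (intro continuous_intros ac_deriv_continuous[OF D])
        then obtain w where w: "w \<in> {s..t}" "\<And>p. p \<in> {s..t} \<Longrightarrow> norm (D p) \<le> norm (D w)"
          using continuous_attains_sup[of "{s..t}" "\<lambda>t. norm (D t)"] q by blast
        have bd: "norm (D q - D p) \<le> norm (D w) / 2" if "p \<in> {s..t}" "q \<in> {s..t}" "p \<le> q" for p q
        proof -
          have "norm (D q - D p) \<le> integral {p..q} (\<lambda>t. (norm (D w) * K) * norm (A t))"
          proof (rule ac_deriv_norm_le[OF D])
            show "(\<lambda>t. (norm (D w) * K) * norm (A t)) integrable_on {p..q}"
              by (rule integrable_on_mult_right[OF ac_deriv_integrable[OF \<alpha>]])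
            fix t' assume "t' \<in> {p..q}"
            then have "norm (A t') * norm (D t') * K \<le> norm (A t') * norm (D w) * K"
              using that K by (intro mult_right_mono mult_left_mono w) auto
            then show "norm (P (A t') (D t')) \<le> (norm (D w) * K) * norm (A t')"
              using K(2)[of "A t'" "D t'"] by (simp add: algebra_simps)
          qed fact
          also have "\<dots> = norm (D w) * K * (\<alpha> q - \<alpha> p)"
            using ac_deriv_incr[OF \<alpha> \<open>p \<le> q\<close>] by simp
          also have "\<dots> \<le> norm (D w) * K * (1 / (2*K))"
          proof (rule mult_left_mono)
            have "\<bar>\<alpha> q - \<alpha> y\<bar> < 1 / (4*K)" "\<bar>\<alpha> p - \<alpha> y\<bar> < 1 / (4*K)"
              using that st by (auto intro!: d)
            moreover have "1 / (2*K) = 1 / (4*K) + 1 / (4*K)" using K by (simp add: field_simps)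
            ultimately show "\<alpha> q - \<alpha> p \<le> 1 / (2*K)" by linarith
          qed (use K in auto)
          also have "\<dots> = norm (D w) / 2" using K by simp
          finally show ?thesis .
        qed
        have "norm (D w - D r) \<le> norm (D w) / 2"
          using bd[of r w] bd[of w r] r w by (metis le_cases norm_minus_commute)
        then have "norm (D w) \<le> 0" using r by simp
        then show "D q = 0" using w(2)[OF q] by simp
      qed
    qed
  qed
  moreover have "c \<in> {min c x..max c x}" "x \<in> {min c x..max c x}" by auto
  ultimately show ?thesis using \<open>D c = 0\<close> by blast
qed

lemma ac_linear_unique:
  fixes P :: "'a::euclidean_space \<Rightarrow> 'b::euclidean_space \<Rightarrow> 'b"
  assumes P: "bounded_bilinear P" and A: "\<And>s t. A absolutely_integrable_on {s..t}"
    and u: "ac_deriv u (\<lambda>t. P (A t) (u t))" and w: "ac_deriv w (\<lambda>t. P (A t) (w t))" and "u c = w c"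
  shows "u = w"
proof
  fix x
  have "ac_deriv (\<lambda>t. u t - w t) (\<lambda>t. P (A t) (u t - w t))"
    using ac_deriv_diff[OF u w] by (simp add: bounded_bilinear.diff_right[OF P])
  from ac_linear_zero[OF P A this, of c x] show "u x = w x"
    using assms by simp
qed

text \<open>The terms, not the partial sums, of Picard iteration: the iterated integrals of the
  Peano-Baker series.\<close>

primrec picard :: "(real \<Rightarrow> complex^'n^'n) \<Rightarrow> real \<Rightarrow> nat \<Rightarrow> real \<Rightarrow> complex^'n^'n" where
  "picard A l 0 = (\<lambda>x. mat 1)"
| "picard A l (Suc n) = (\<lambda>x. sint l x (\<lambda>t. A t ** picard A l n t))"

lemma
  fixes A :: "real \<Rightarrow> complex^'n^'n"
  assumes A: "\<And>s t. A absolutely_integrable_on {s..t}"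
  shows picard_continuous: "continuous_on UNIV (picard A l n)"
    and picard_ac: "ac_deriv (picard A l (Suc n)) (\<lambda>t. A t ** picard A l n t)"
proof -
  have step: "ac_deriv (picard A l (Suc n)) (\<lambda>t. A t ** picard A l n t)"
    if "continuous_on UNIV (picard A l n)" for n
    using ac_deriv_sint[where c = 0, OF absint_continuous_bilinear[OF bounded_bilinear.flip[OF bounded_bilinear_matrix_mult] that A]]
    by simp
  show c: "continuous_on UNIV (picard A l n)" for n
    by (induction n) (auto dest: step[THEN ac_deriv_continuous] simp del: picard.simps(2))
  show "ac_deriv (picard A l (Suc n)) (\<lambda>t. A t ** picard A l n t)"
    by (rule step[OF c])
qed

text \<open>With \<alpha> the integral of \<open>a\<close> from l, integrating
  \<open>real (Suc n) * a * \<alpha> ^ n\<close> gives the next power of \<alpha>, whence the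
  factorial. A majorant \<open>a\<close> replaces \<open>norm (A t)\<close> so that one bound can
  serve a whole disc of parameters z.\<close>

lemma picard_bound:
  fixes A :: "real \<Rightarrow> complex^'n^'n"
  assumes A: "\<And>s t. A absolutely_integrable_on {s..t}"
    and a: "\<And>s t. a absolutely_integrable_on {s..t}" "\<And>t. norm (A t) \<le> a t"
    and K: "K > 0" "\<And>(M :: complex^'n^'n) (N :: complex^'n^'n). norm (M ** N) \<le> norm M * norm N * K"
  shows "norm (picard A l n x) \<le> norm (mat 1 :: complex^'n^'n) * ((K * \<bar>sint l x a\<bar>) ^ n / fact n)"
proof (induction n arbitrary: x)
  case 0
  show ?case by simp
next
  case (Suc n)
  define \<alpha> where "\<alpha> x = sint l x a" for x
  define N where "N = norm (mat 1 :: complex^'n^'n)"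
  define c where "c = N * K ^ Suc n / fact (Suc n)"
  have IH: "norm (picard A l n x) \<le> N * ((K * \<bar>\<alpha> x\<bar>) ^ n / fact n)" for x
    using Suc unfolding N_def \<alpha>_def .
  have a0: "a t \<ge> 0" for t using a(2)[of t] norm_ge_zero order_trans by blast
  have \<alpha>: "ac_deriv \<alpha> a" using ac_deriv_sint[of a 0 l] a by (simp add: \<alpha>_def[abs_def])
  have \<alpha>m: "ac_deriv (\<lambda>x. - \<alpha> x) (\<lambda>x. - a x)"
    by (rule ac_deriv_linear[OF bounded_linear_minus[OF bounded_linear_ident] \<alpha>])
  have pos: "\<alpha> t \<ge> 0" if "l \<le> t" for t
    using that a a0 by (auto simp: \<alpha>_def sint_def intro!: integral_nonneg set_lebesgue_integral_eq_integral(1))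
  have neg: "\<alpha> t \<le> 0" if "t \<le> l" for t
    using that a a0 by (auto simp: \<alpha>_def sint_def intro!: integral_nonneg set_lebesgue_integral_eq_integral(1))
  have le: "norm (A t ** picard A l n t) \<le> c * (real (Suc n) * a t * \<bar>\<alpha> t\<bar> ^ n)" for t
  proof -
    have "norm (A t ** picard A l n t) \<le> norm (A t) * norm (picard A l n t) * K" by (rule K)
    also have "\<dots> \<le> a t * (N * ((K * \<bar>\<alpha> t\<bar>) ^ n / fact n)) * K"
      using K a0 by (intro mult_mono IH a(2) mult_nonneg_nonneg) (auto simp: N_def)
    also have "\<dots> = c * (real (Suc n) * a t * \<bar>\<alpha> t\<bar> ^ n)"
      by (simp add: c_def field_simps power_mult_distrib del: of_nat_Suc)
    finally show ?thesis .
  qed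
  have "norm (picard A l (Suc n) x) \<le> c * \<bar>\<alpha> x\<bar> ^ Suc n"
  proof (cases "l \<le> x")
    case True
    have ac: "ac_deriv (\<lambda>x. c * \<alpha> x ^ Suc n) (\<lambda>x. c * (real (Suc n) * a x * \<alpha> x ^ n))"
      by (rule ac_deriv_linear[OF bounded_linear_mult_right ac_deriv_power[OF \<alpha>]])
    have "norm (picard A l (Suc n) x - picard A l (Suc n) l)
        \<le> integral {l..x} (\<lambda>x. c * (real (Suc n) * a x * \<alpha> x ^ n))"
      by (rule ac_deriv_norm_le[OF picard_ac[OF A] ac_deriv_integrable[OF ac]])
        (use le pos True in \<open>metis atLeastAtMost_iff abs_of_nonneg\<close>, fact)
    also have "\<dots> = c * \<alpha> x ^ Suc n - c * \<alpha> l ^ Suc n"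
      using ac_deriv_incr[OF ac True] by simp
    finally show ?thesis using pos[OF True] by (simp add: \<alpha>_def)
  next
    case False
    then have xl: "x \<le> l" by simp
    \<comment> \<open>Left of l the integral \<alpha> is nonpositive; the same computation runs with
      \<open>- \<alpha>\<close>, and the leading \<open>- c\<close> restores the sign of the
      derivative.\<close>
    have le': "norm (A t ** picard A l n t) \<le> - c * (real (Suc n) * (- a t) * (- \<alpha> t) ^ n)" if "t \<in> {x..l}" for t
      using le[of t] neg[of t] that by (simp add: abs_of_nonpos)
    have ac: "ac_deriv (\<lambda>x. - c * (- \<alpha> x) ^ Suc n) (\<lambda>x. - c * (real (Suc n) * (- a x) * (- \<alpha> x) ^ n))"
      by (rule ac_deriv_linear[OF bounded_linear_mult_right ac_deriv_power[OF \<alpha>m]])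
    have "norm (picard A l (Suc n) l - picard A l (Suc n) x)
        \<le> integral {x..l} (\<lambda>x. - c * (real (Suc n) * (- a x) * (- \<alpha> x) ^ n))"
      by (rule ac_deriv_norm_le[OF picard_ac[OF A] ac_deriv_integrable[OF ac]])
        (use le' in simp, fact)
    also have "\<dots> = - c * (- \<alpha> l) ^ Suc n - (- c * (- \<alpha> x) ^ Suc n)"
      using ac_deriv_incr[OF ac xl] by simp
    finally show ?thesis using neg[OF xl] by (simp add: \<alpha>_def abs_of_nonpos)
  qed
  also have "\<dots> = N * ((K * \<bar>\<alpha> x\<bar>) ^ Suc n / fact (Suc n))"
    by (simp add: c_def power_mult_distrib)
  finally show ?case unfolding N_def \<alpha>_def .
qed

lemma summable_exp_bound: "summable (\<lambda>n. N * (y ^ n / fact n :: real))"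
  using summable_exp[of y] by (intro summable_mult) (simp add: field_simps)

definition fundamental :: "(real \<Rightarrow> complex^'n^'n) \<Rightarrow> real \<Rightarrow> real \<Rightarrow> complex^'n^'n" where
  "fundamental A l x = (\<Sum>n. picard A l n x)"

lemma fundamental_self: "fundamental (A :: real \<Rightarrow> complex^'n^'n) l l = mat 1"
proof -
  have "picard A l n l = (if n = 0 then mat 1 else 0)" for n by (cases n) auto
  then show ?thesis
    using sums_unique[OF sums_single[of 0 "\<lambda>_. mat 1 :: complex^'n^'n"]]
    by (simp add: fundamental_def)
qed

text \<open>Both sides of the integral equation for the partial sums converge: the left one
  pointwise, the right one by dominated convergence.\<close>

lemma fundamental_ac:
  fixes A :: "real \<Rightarrow> complex^'n^'n"
  assumes A: "\<And>s t. A absolutely_integrable_on {s..t}"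
  shows "ac_deriv (fundamental A l) (\<lambda>t. A t ** fundamental A l t)"
proof -
  obtain K where K: "K > 0" "\<And>(M :: complex^'n^'n) (N :: complex^'n^'n). norm (M ** N) \<le> norm M * norm N * K"
    using bounded_bilinear.pos_bounded[OF bounded_bilinear_matrix_mult] by blast
  define a where "a t = norm (A t)" for t
  have a: "a absolutely_integrable_on {s..t}" for s t
    unfolding a_def by (rule absint_norm[OF A])
  define N where "N = norm (mat 1 :: complex^'n^'n)"
  define \<alpha> where "\<alpha> x = sint l x a" for x
  have b: "norm (picard A l n x) \<le> N * ((K * \<bar>\<alpha> x\<bar>) ^ n / fact n)" for n x
    unfolding N_def \<alpha>_def by (rule picard_bound[OF A a _ K]) (simp add: a_def)
  have sm: "summable (\<lambda>n. norm (picard A l n x))" for x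
    by (rule summable_comparison_test'[OF summable_exp_bound]) (use b in auto)
  have \<alpha>c: "continuous_on UNIV \<alpha>"
    using ac_deriv_sint[of a 0 l] a by (intro ac_deriv_continuous) (simp add: \<alpha>_def[abs_def])
  define S where "S n x = (\<Sum>i<n. picard A l i x)" for n x
  have S: "(\<lambda>n. S n x) \<longlonglongrightarrow> fundamental A l x" for x
    unfolding S_def fundamental_def by (rule summable_LIMSEQ[OF summable_norm_cancel[OF sm]])
  have S_c: "continuous_on UNIV (S n)" for n
    unfolding S_def by (intro continuous_intros picard_continuous A)
  \<comment> \<open>The derivative lags one index behind, because the zeroth term is constant; hence
    the limit of the increments is later taken along \<open>Suc n\<close>.\<close>
  have S_ac: "ac_deriv (S (Suc n)) (\<lambda>t. A t ** S n t)" for n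
  proof (induction n)
    case 0
    then show ?case by (simp add: S_def ac_deriv_def)
  next
    case (Suc n)
    have "(\<lambda>x. S (Suc n) x + picard A l (Suc n) x) = S (Suc (Suc n))"
      by (rule ext) (simp add: S_def)
    moreover have "(\<lambda>x. A x ** S n x + A x ** picard A l n x) = (\<lambda>t. A t ** S (Suc n) t)"
      by (rule ext) (simp add: S_def matrix_add_ldistrib)
    ultimately show ?case
      using ac_deriv_add[OF Suc picard_ac[OF A, of l n]] by simp
  qed
  have AS: "(\<lambda>t. A t ** S n t) absolutely_integrable_on {s..t}" for n s t
    by (rule ac_deriv_absint[OF S_ac])
  have "(\<lambda>t. A t ** fundamental A l t) absolutely_integrable_on {s..t} \<and>
        (\<lambda>k. integral {s..t} (\<lambda>t. A t ** S k t)) \<longlonglongrightarrow> integral {s..t} (\<lambda>t. A t ** fundamental A l t)" for s t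
  proof -
    have "bounded (\<alpha> ` {s..t})"
      by (meson \<alpha>c compact_Icc compact_continuous_image compact_imp_bounded continuous_on_subset subset_UNIV)
    then obtain B where "\<forall>y\<in>\<alpha> ` {s..t}. norm y \<le> B"
      unfolding bounded_iff by blast
    then have B: "\<bar>\<alpha> x\<bar> \<le> B" if "x \<in> {s..t}" for x
      using that by simp
    \<comment> \<open>The majorant series at a bound for \<open>\<bar>\<alpha>\<bar>\<close> on the
      interval; it bounds all partial sums at once and so supplies the dominating function.\<close>
    define M where "M = (\<Sum>n. N * ((K * B) ^ n / fact n))"
    have le: "norm (S n x) \<le> M" if "x \<in> {s..t}" for n x
    proof -
      have B0: "B \<ge> 0" using B[OF that] by linarith
      have "norm (S n x) \<le> (\<Sum>i<n. N * ((K * B) ^ i / fact i))"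
        unfolding S_def
      proof (rule sum_norm_le)
        fix i
        have "N * ((K * \<bar>\<alpha> x\<bar>) ^ i / fact i) \<le> N * ((K * B) ^ i / fact i)"
          using B[OF that] K by (intro mult_left_mono divide_right_mono power_mono) (auto simp: N_def)
        then show "norm (picard A l i x) \<le> N * ((K * B) ^ i / fact i)"
          using b order_trans by blast
      qed
      also have "\<dots> \<le> M"
        unfolding M_def using B0 K by (intro sum_le_suminf summable_exp_bound) (auto simp: N_def)
      finally show ?thesis .
    qed
    define h where "h t = (M * K) * a t" for t
    have h: "h integrable_on {s..t}"
      unfolding h_def using a by (intro integrable_on_mult_right) (simp add: set_lebesgue_integral_eq_integral(1))
    have leh: "norm (A x ** S n x) \<le> h x" if "x \<in> {s..t}" for n x
    proof -
      have "norm (A x ** S n x) \<le> norm (A x) * norm (S n x) * K" by (rule K)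
      also have "\<dots> \<le> norm (A x) * M * K"
        using K by (intro mult_right_mono mult_left_mono le that) auto
      finally show ?thesis by (simp add: h_def a_def algebra_simps)
    qed
    have lim: "(\<lambda>n. A x ** S n x) \<longlonglongrightarrow> A x ** fundamental A l x" for x
      by (rule bounded_bilinear.tendsto[OF bounded_bilinear_matrix_mult tendsto_const S])
    have ngh: "norm (A x ** fundamental A l x) \<le> h x" if "x \<in> {s..t}" for x
      by (rule Lim_bounded[OF tendsto_norm[OF lim]]) (use leh that in blast)
    have "(\<lambda>t. A t ** fundamental A l t) absolutely_integrable_on {s..t}"
      by (rule dominated_convergence_absolutely_integrable[OF AS h ngh lim])
    moreover have "(\<lambda>k. integral {s..t} (\<lambda>t. A t ** S k t)) \<longlonglongrightarrow> integral {s..t} (\<lambda>t. A t ** fundamental A l t)"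
      by (rule dominated_convergence(2)[OF _ h leh lim]) (use AS in \<open>auto simp: set_lebesgue_integral_eq_integral(1)\<close>)
    ultimately show ?thesis by blast
  qed
  moreover have "fundamental A l t - fundamental A l s = integral {s..t} (\<lambda>t. A t ** fundamental A l t)"
    if "s \<le> t" for s t
  proof (rule LIMSEQ_unique)
    show "(\<lambda>n. S (Suc n) t - S (Suc n) s) \<longlonglongrightarrow> fundamental A l t - fundamental A l s"
      by (intro tendsto_diff LIMSEQ_Suc S)
    show "(\<lambda>n. S (Suc n) t - S (Suc n) s) \<longlonglongrightarrow> integral {s..t} (\<lambda>t. A t ** fundamental A l t)"
      using calculation[of s t] ac_deriv_incr[OF S_ac that] by simp
  qed
  ultimately show ?thesis unfolding ac_deriv_def by simp
qed

section \<open>Holomorphic dependence on the parameter\<close>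

text \<open>Multiplication by a complex scalar; \<open>scaleR\<close> on this type only takes real
  ones.\<close>

definition cmat :: "complex \<Rightarrow> complex^'n^'m \<Rightarrow> complex^'n^'m" where
  "cmat z M = (\<chi> i j. z * M $ i $ j)"

lemma cmat_nth [simp]: "cmat z M $ i $ j = z * M $ i $ j"
  by (simp add: cmat_def)

lemma cmat_mult:
  "cmat z M ** N = cmat z (M ** N)" "M ** cmat z N = cmat z (M ** N)"
  by (simp_all add: vec_eq_iff matrix_matrix_mult_def sum_distrib_left mult.left_commute mult.assoc)

lemma bounded_linear_cmat: "bounded_linear (cmat z)"
  unfolding linear_conv_bounded_linear[symmetric]
  by (intro linearI) (simp_all add: vec_eq_iff algebra_simps)

lemma norm_le_sum_entries:
  fixes M :: "complex^'n^'m"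
  shows "norm M \<le> (\<Sum>i\<in>UNIV. \<Sum>j\<in>UNIV. norm (M $ i $ j))"
  unfolding norm_vec_def
  by (rule order.trans[OF L2_set_le_sum]) (auto simp: L2_set_nonneg intro!: sum_mono L2_set_le_sum)

lemma absint_vec:
  fixes f :: "real \<Rightarrow> 'e::euclidean_space^'n"
  assumes "\<And>i. (\<lambda>x. f x $ i) absolutely_integrable_on S"
  shows "f absolutely_integrable_on S"
proof (rule absolutely_integrable_componentwise)
  fix b :: "'e^'n" assume "b \<in> Basis"
  then obtain i u where b: "b = axis i u" unfolding Basis_vec_def by auto
  show "(\<lambda>x. f x \<bullet> b) absolutely_integrable_on S"
    using absolutely_integrable_component[OF assms[of i], of u] by (simp add: b inner_axis)
qed

lemma sint_linear:
  assumes "bounded_linear L" "\<And>s t. f absolutely_integrable_on {s..t}"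
  shows "sint l x (\<lambda>t. L (f t)) = L (sint l x f)"
  using ac_deriv_eq_sint[OF ac_deriv_linear[OF assms(1) ac_deriv_sint[OF assms(2), of 0 l]], of x l]
  by (simp add: linear_simps[OF assms(1)])

lemma sint_add:
  assumes "\<And>s t. f absolutely_integrable_on {s..t}" "\<And>s t. g absolutely_integrable_on {s..t}"
  shows "sint l x (\<lambda>t. f t + g t) = sint l x f + sint l x g"
  using ac_deriv_eq_sint[OF ac_deriv_add[OF ac_deriv_sint[OF assms(1), of 0 l] ac_deriv_sint[OF assms(2), of 0 l]], of x l]
  by simp

text \<open>Functions polynomial in \<open>z\<close> with coefficients continuous in \<open>x\<close>, presented by closure rules
  so that the integral operator can be applied without re-indexing.\<close>
inductive poly_family :: "(complex \<Rightarrow> real \<Rightarrow> complex^'n^'n) \<Rightarrow> bool" where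
  base: "continuous_on UNIV c \<Longrightarrow> poly_family (\<lambda>z. c)"
| add: "poly_family F \<Longrightarrow> poly_family G \<Longrightarrow> poly_family (\<lambda>z x. F z x + G z x)"
| scale: "poly_family F \<Longrightarrow> poly_family (\<lambda>z x. cmat z (F z x))"

lemma poly_family_continuous: "poly_family F \<Longrightarrow> continuous_on UNIV (F z)"
  by (induction rule: poly_family.induct)
    (auto intro!: continuous_intros bounded_linear.continuous_on[OF bounded_linear_cmat])

lemma poly_family_holomorphic: "poly_family F \<Longrightarrow> (\<lambda>z. F z x $ i $ j) holomorphic_on S"
  by (induction rule: poly_family.induct) (auto intro!: holomorphic_intros)

text \<open>For a coefficient constant in z the integral splits into z times one continuous function
  plus another; sums and multiplication by z pass through the integral, so the closure rules carry
  the rest.\<close>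

lemma poly_family_sint:
  fixes B :: "complex^'n^'n" and C :: "real \<Rightarrow> complex^'n^'n"
  assumes C: "\<And>s t. C absolutely_integrable_on {s..t}"
    and "poly_family F"
  shows "poly_family (\<lambda>z x. sint l x (\<lambda>t. (cmat z B + C t) ** F z t))"
  using assms(2)
proof (induction rule: poly_family.induct)
  note absint = absint_continuous_bilinear[OF bounded_bilinear.flip[OF bounded_bilinear_matrix_mult]]
  have const: "(\<lambda>x. M) absolutely_integrable_on {s..t}" for M :: "complex^'n^'n" and s t :: real
    by (rule absolutely_integrable_continuous_real) simp
  have coef: "(\<lambda>t. cmat z B + C t) absolutely_integrable_on {s..t}" for z s t
    by (intro set_integral_add const C)
  {
    case (base c)
    have 1: "(\<lambda>t. B ** c t) absolutely_integrable_on {s..t}" for s t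
      by (rule absint[OF base const])
    have 2: "(\<lambda>t. C t ** c t) absolutely_integrable_on {s..t}" for s t
      by (rule absint[OF base C])
    have 3: "(\<lambda>t. cmat z (B ** c t)) absolutely_integrable_on {s..t}" for s t z
      using absolutely_integrable_linear[OF 1 bounded_linear_cmat] by (simp add: o_def)
    have cont: "continuous_on UNIV (\<lambda>x. sint l x (\<lambda>t. B ** c t))" "continuous_on UNIV (\<lambda>x. sint l x (\<lambda>t. C t ** c t))"
      using ac_deriv_continuous[OF ac_deriv_sint[OF 1, of 0 l]] ac_deriv_continuous[OF ac_deriv_sint[OF 2, of 0 l]]
      by simp_all
    have "poly_family (\<lambda>z x. cmat z (sint l x (\<lambda>t. B ** c t)) + sint l x (\<lambda>t. C t ** c t))"
      by (intro poly_family.intros cont)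
    also have "(\<lambda>z x. cmat z (sint l x (\<lambda>t. B ** c t)) + sint l x (\<lambda>t. C t ** c t))
      = (\<lambda>z x. sint l x (\<lambda>t. (cmat z B + C t) ** c t))"
      by (intro ext) (simp add: sint_linear[OF bounded_linear_cmat 1, symmetric] sint_add[OF 3 2, symmetric]
          bounded_bilinear.add_left[OF bounded_bilinear_matrix_mult] cmat_mult)
    finally show ?case .
  next
    case (add F G)
    have "(\<lambda>z x. sint l x (\<lambda>t. (cmat z B + C t) ** F z t) + sint l x (\<lambda>t. (cmat z B + C t) ** G z t))
      = (\<lambda>z x. sint l x (\<lambda>t. (cmat z B + C t) ** (F z t + G z t)))"
      by (intro ext)
        (simp add: matrix_add_ldistrib sint_add absint[OF poly_family_continuous coef] add.hyps)
    with poly_family.add[OF add.IH] show ?case by simp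
  next
    case (scale F)
    have "(\<lambda>z x. cmat z (sint l x (\<lambda>t. (cmat z B + C t) ** F z t)))
      = (\<lambda>z x. sint l x (\<lambda>t. (cmat z B + C t) ** cmat z (F z t)))"
      by (intro ext)
        (simp add: cmat_mult sint_linear[OF bounded_linear_cmat] absint[OF poly_family_continuous coef] scale.hyps)
    with poly_family.scale[OF scale.IH] show ?case by simp
  }
qed

lemma poly_family_picard:
  fixes B :: "complex^'n^'n"
  assumes "\<And>s t. C absolutely_integrable_on {s..t}"
  shows "poly_family (\<lambda>z. picard (\<lambda>t. cmat z B + C t) l n)"
proof (induction n)
  case 0
  show ?case by (simp add: poly_family.base)
next
  case (Suc n)
  from poly_family_sint[OF assms this] show ?case by simp
qed

text \<open>The partial sums are polynomials in z. Near a given w all coefficients share one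
  integrable majorant, so the Weierstrass test makes the convergence locally uniform.\<close>

lemma fundamental_holomorphic:
  fixes B :: "complex^'n^'n"
  assumes C: "\<And>s t. C absolutely_integrable_on {s..t}"
  shows "(\<lambda>z. fundamental (\<lambda>t. cmat z B + C t) l x $ i $ j) holomorphic_on UNIV"
proof (rule holomorphic_uniform_sequence[where f = "\<lambda>n z. (\<Sum>k<n. picard (\<lambda>t. cmat z B + C t) l k x) $ i $ j"])
  show "(\<lambda>z. (\<Sum>k<n. picard (\<lambda>t. cmat z B + C t) l k x) $ i $ j) holomorphic_on UNIV" for n
    using poly_family_holomorphic[OF poly_family_picard[OF C]] by (auto intro!: holomorphic_intros)
  fix w :: complex
  obtain K where K: "K > 0" "\<And>(M :: complex^'n^'n) (N :: complex^'n^'n). norm (M ** N) \<le> norm M * norm N * K"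
    using bounded_bilinear.pos_bounded[OF bounded_bilinear_matrix_mult] by blast
  \<comment> \<open>On the unit disc around w the modulus of z is at most \<open>norm w + 1\<close>;
    summing over entries bounds the matrix norm of the z-dependent part.\<close>
  define a where "a t = (\<Sum>i\<in>UNIV. \<Sum>j\<in>UNIV. (norm w + 1) * norm (B $ i $ j)) + norm (C t)" for t
  have a: "a absolutely_integrable_on {s..t}" for s t
    unfolding a_def by (intro set_integral_add absint_norm C absolutely_integrable_continuous_real) auto
  have const: "(\<lambda>x. M) absolutely_integrable_on {s..t}" for M :: "complex^'n^'n" and s t :: real
    by (rule absolutely_integrable_continuous_real) simp
  have le: "norm (cmat z B + C t) \<le> a t" if "z \<in> cball w 1" for z t
  proof -
    have "norm z \<le> norm w + 1"
      using that norm_triangle_sub[of z w] by (simp add: dist_norm norm_minus_commute)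
    then have "norm (cmat z B) \<le> (\<Sum>i\<in>UNIV. \<Sum>j\<in>UNIV. (norm w + 1) * norm (B $ i $ j))"
      by (intro order.trans[OF norm_le_sum_entries] sum_mono) (simp add: norm_mult mult_right_mono)
    then show ?thesis
      unfolding a_def using norm_triangle_ineq[of "cmat z B" "C t"] by linarith
  qed
  have "uniform_limit (cball w 1) (\<lambda>n z. \<Sum>k<n. picard (\<lambda>t. cmat z B + C t) l k x)
      (\<lambda>z. \<Sum>k. picard (\<lambda>t. cmat z B + C t) l k x) sequentially"
  proof (rule Weierstrass_m_test)
    show "norm (picard (\<lambda>t. cmat z B + C t) l n x) \<le>
        norm (mat 1 :: complex^'n^'n) * ((K * \<bar>sint l x a\<bar>) ^ n / fact n)" if "z \<in> cball w 1" for n z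
      by (rule picard_bound[OF _ a le[OF that] K]) (intro set_integral_add const C)
  qed (rule summable_exp_bound)
  then have "uniform_limit (cball w 1) (\<lambda>n z. \<Sum>k<n. picard (\<lambda>t. cmat z B + C t) l k x)
      (\<lambda>z. fundamental (\<lambda>t. cmat z B + C t) l x) sequentially"
    by (simp add: fundamental_def)
  from bounded_linear.uniform_limit[OF bounded_linear_compose[OF bounded_linear_vec_nth bounded_linear_vec_nth] this, of i j]
  show "\<exists>d>0. cball w d \<subseteq> UNIV \<and> uniform_limit (cball w d)
      (\<lambda>n z. (\<Sum>k<n. picard (\<lambda>t. cmat z B + C t) l k x) $ i $ j)
      (\<lambda>z. fundamental (\<lambda>t. cmat z B + C t) l x $ i $ j) sequentially"
    by (intro exI[of _ 1]) simp
qed simp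

section \<open>The Dirac system and its energy identity\<close>

lemma sum_UNIV_plus:
  fixes f :: "'a::finite + 'b::finite \<Rightarrow> 'c::comm_monoid_add"
  shows "(\<Sum>i\<in>UNIV. f i) = (\<Sum>a\<in>UNIV. f (Inl a)) + (\<Sum>b\<in>UNIV. f (Inr b))"
  by (simp flip: UNIV_Plus_UNIV add: sum.Plus)

text \<open>The indefinite form Re(y* J w). The real inner product of complex entries keeps it
  bilinear over the reals, so the product rule for \<open>ac_deriv\<close> applies to it.\<close>

definition kform :: "complex^('a::finite + 'b::finite) \<Rightarrow> complex^('a + 'b) \<Rightarrow> real" where
  "kform w y = (\<Sum>a\<in>UNIV. w $ Inl a \<bullet> y $ Inl a) - (\<Sum>b\<in>UNIV. w $ Inr b \<bullet> y $ Inr b)"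

lemma bounded_bilinear_kform: "bounded_bilinear kform"
proof -
  have "bilinear kform"
    unfolding bilinear_def
    by (intro conjI allI linearI)
      (simp_all add: kform_def inner_left_distrib inner_right_distrib sum.distrib
        sum_distrib_left right_diff_distrib)
  then show ?thesis by (simp add: bilinear_conv_bounded_bilinear)
qed

lemma kform_commute: "kform w y = kform y w"
  by (simp add: kform_def inner_commute)

lemma power2_norm_vec:
  fixes y :: "'e::real_inner^'n"
  shows "(norm y)\<^sup>2 = (\<Sum>i\<in>UNIV. (norm (y $ i))\<^sup>2)"
  by (simp add: power2_norm_eq_inner inner_vec_def)

lemma kform_self:
  "kform y y = (\<Sum>a\<in>UNIV. (norm (y $ Inl a))\<^sup>2) - (\<Sum>b\<in>UNIV. (norm (y $ Inr b))\<^sup>2)"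
  by (simp add: kform_def power2_norm_eq_inner)

lemma abs_kform_le: "\<bar>kform y y\<bar> \<le> (norm y)\<^sup>2"
  unfolding power2_norm_vec sum_UNIV_plus kform_self
  by (simp add: abs_le_iff sum_nonneg)

lemma Jmat_nth [simp]:
  "Jmat $ Inl a $ Inl a' = (if a = a' then 1 else 0)" "Jmat $ Inl a $ Inr b = 0"
  "Jmat $ Inr b $ Inl a = 0" "Jmat $ Inr b $ Inr b' = (if b = b' then -1 else 0)"
  by (auto simp: Jmat_def)

lemma Vpot_nth [simp]:
  "Vpot v x $ Inl a $ Inl a' = 0" "Vpot v x $ Inr b $ Inr b' = 0"
  "Vpot v x $ Inl a $ Inr b = (if x < 0 then 0 else v x $ a $ b)"
  "Vpot v x $ Inr b $ Inl a = (if x < 0 then 0 else cnj (v x $ a $ b))"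
  by (auto simp: Vpot_def)

lemma dirac_coef_nth:
  "dirac_coef v z x $ Inl a $ Inl a' = (if a = a' then \<i> * z else 0)"
  "dirac_coef v z x $ Inr b $ Inr b' = (if b = b' then - \<i> * z else 0)"
  "dirac_coef v z x $ Inl a $ Inr b = \<i> * Vpot v x $ Inl a $ Inr b"
  "dirac_coef v z x $ Inr b $ Inl a = - \<i> * cnj (Vpot v x $ Inl a $ Inr b)"
  by (auto simp: dirac_coef_def matrix_matrix_mult_def sum_UNIV_plus if_distrib if_distribR cong: if_cong)

lemma dirac_coef_affine: "dirac_coef v z x = cmat z (cmat \<i> Jmat) + cmat \<i> (Jmat ** Vpot v x)"
  by (simp add: vec_eq_iff dirac_coef_def algebra_simps)

text \<open>J times the coefficient is i(z + V). As V is Hermitian, its contribution is i times a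
  real number and drops out of the real part; only the term with Im z remains.\<close>

lemma kform_dirac_coef:
  "kform (dirac_coef v z x *v y) y + kform y (dirac_coef v z x *v y) = - 2 * Im z * (norm y)\<^sup>2"
proof -
  let ?W = "\<lambda>a b. Vpot v x $ Inl a $ Inr b"
  \<comment> \<open>The contribution of the upper off-diagonal block; the lower one gives
    \<open>cnj S\<close>, and \<open>\<i> * (S + cnj S)\<close> has real part 0.\<close>
  define S where "S = (\<Sum>a\<in>UNIV. \<Sum>b\<in>UNIV. ?W a b * y $ Inr b * cnj (y $ Inl a))"
  have cS: "(\<Sum>b\<in>UNIV. \<Sum>a\<in>UNIV. cnj (?W a b) * y $ Inl a * cnj (y $ Inr b)) = cnj S"
    unfolding S_def by (subst sum.swap) (simp add: mult.assoc mult.commute mult.left_commute)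
  have inner: "p \<bullet> q = Re (p * cnj q)" for p q :: complex
    by (simp add: inner_complex_def)
  have l: "(dirac_coef v z x *v y) $ Inl a = \<i> * z * y $ Inl a + \<i> * (\<Sum>b\<in>UNIV. ?W a b * y $ Inr b)" for a
    by (simp add: matrix_vector_mult_def sum_UNIV_plus dirac_coef_nth if_distrib sum_distrib_left
        mult.assoc if_distribR cong: if_cong del: Vpot_nth)
  have r: "(dirac_coef v z x *v y) $ Inr b = - \<i> * z * y $ Inr b - \<i> * (\<Sum>a\<in>UNIV. cnj (?W a b) * y $ Inl a)" for b
    by (simp add: matrix_vector_mult_def sum_UNIV_plus dirac_coef_nth if_distrib sum_distrib_left
        mult.assoc if_distribR sum_negf cong: if_cong del: Vpot_nth)
  let ?Na = "\<Sum>a\<in>UNIV. y $ Inl a * cnj (y $ Inl a)" and ?Nb = "\<Sum>b\<in>UNIV. y $ Inr b * cnj (y $ Inr b)"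
  have "kform (dirac_coef v z x *v y) y =
      Re ((\<Sum>a\<in>UNIV. (dirac_coef v z x *v y) $ Inl a * cnj (y $ Inl a))
        - (\<Sum>b\<in>UNIV. (dirac_coef v z x *v y) $ Inr b * cnj (y $ Inr b)))"
    by (simp add: kform_def inner)
  also have "(\<Sum>a\<in>UNIV. (dirac_coef v z x *v y) $ Inl a * cnj (y $ Inl a)) = \<i> * z * ?Na + \<i> * S"
    unfolding l S_def by (simp add: distrib_right sum.distrib sum_distrib_left sum_distrib_right mult.assoc)
  also have "(\<Sum>b\<in>UNIV. (dirac_coef v z x *v y) $ Inr b * cnj (y $ Inr b)) = - (\<i> * z * ?Nb) - \<i> * cnj S"
    unfolding r cS[symmetric]
    by (simp add: left_diff_distrib sum_subtractf sum_distrib_left sum_distrib_right mult.assoc sum_negf)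
  also have "Re (\<i> * z * ?Na + \<i> * S - (- (\<i> * z * ?Nb) - \<i> * cnj S)) = Re (\<i> * z * (?Na + ?Nb))"
    by (simp add: algebra_simps)
  also have "?Na + ?Nb = complex_of_real ((norm y)\<^sup>2)"
    by (simp add: power2_norm_vec sum_UNIV_plus complex_norm_square del: of_real_power)
  also have "Re (\<i> * z * complex_of_real ((norm y)\<^sup>2)) = - Im z * (norm y)\<^sup>2"
    by simp
  finally show ?thesis by (simp add: kform_commute[of y])
qed

text \<open>The definition only asks for integrability of the product. The integral equation makes u
  continuous, and then the product is absolutely integrable because the coefficient is.\<close>

lemma is_fund_sol_iff:
  assumes "\<And>s t. dirac_coef v z absolutely_integrable_on {s..t}"
  shows "is_fund_sol v l z u \<longleftrightarrow> u l = mat 1 \<and> ac_deriv u (\<lambda>t. dirac_coef v z t ** u t)"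
proof
  assume "is_fund_sol v l z u"
  then have i: "(\<lambda>t. dirac_coef v z t ** u t) integrable_on {a..b}"
    and u: "u x = mat 1 + sint l x (\<lambda>t. dirac_coef v z t ** u t)" for a b x
    unfolding is_fund_sol_def by blast+
  let ?f = "\<lambda>t. dirac_coef v z t ** u t"
  have incr: "u t - u s = integral {s..t} ?f" if "s \<le> t" for s t
  proof -
    have "u t - u s = sint l t ?f - sint l s ?f"
      by (subst u[of t], subst u[of s]) simp
    also have "\<dots> = integral {s..t} ?f"
      using that by (rule sint_diff[OF i])
    finally show ?thesis .
  qed
  have "isCont u x" for x
  proof -
    have "continuous_on {x-1..x+1} (\<lambda>t. u (x-1) + integral {x-1..t} ?f)"
      by (intro continuous_intros indefinite_integral_continuous_1 i)
    then have "continuous_on {x-1..x+1} u"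
      by (rule continuous_on_eq) (simp flip: incr)
    then show ?thesis
      by (rule continuous_on_interior) auto
  qed
  then have "continuous_on UNIV u"
    by (simp add: continuous_at_imp_continuous_on)
  then have "?f absolutely_integrable_on {s..t}" for s t
    by (rule absint_continuous_bilinear[OF bounded_bilinear.flip[OF bounded_bilinear_matrix_mult] _ assms])
  with incr have "ac_deriv u ?f" by (simp add: ac_deriv_def)
  moreover have "u l = mat 1" by (subst u) simp
  ultimately show "u l = mat 1 \<and> ac_deriv u ?f" by blast
next
  assume "u l = mat 1 \<and> ac_deriv u (\<lambda>t. dirac_coef v z t ** u t)"
  then have l: "u l = mat 1" and u: "ac_deriv u (\<lambda>t. dirac_coef v z t ** u t)"
    by simp_all
  show "is_fund_sol v l z u"
    unfolding is_fund_sol_def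
  proof (intro conjI allI)
    show "(\<lambda>t. dirac_coef v z t ** u t) integrable_on {a..b}" for a b
      by (rule ac_deriv_integrable[OF u])
    show "u x = mat 1 + sint l x (\<lambda>t. dirac_coef v z t ** u t)" for x
      using ac_deriv_eq_sint[OF u, of x l] unfolding l .
  qed
qed

section \<open>The fundamental solution for a locally integrable potential\<close>

locale dirac_system =
  fixes v :: "real \<Rightarrow> complex^'b::finite^'a::finite"
  assumes v_loc_L1: "\<forall>R>0. \<forall>a b. (\<lambda>x. v x $ a $ b) absolutely_integrable_on {0<..<R}"
begin

lemma Vpot_absint: "Vpot v absolutely_integrable_on {s..t}"
proof -
  have 1: "(\<lambda>x. Vpot v x $ Inl a $ Inr b) absolutely_integrable_on {s..t}" for a b
  proof (rule absolutely_integrable_spike)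
    \<comment> \<open>Large enough for t to lie strictly inside. The hypothesis speaks of the open
      interval, so the point 0, where \<open>Vpot\<close> already equals v, is discarded as a null
      set.\<close>
    let ?R = "\<bar>t\<bar> + 1"
    have "(\<lambda>x. v x $ a $ b) absolutely_integrable_on {0<..<?R}"
      using v_loc_L1 by simp
    then have "(\<lambda>x. if x \<in> {0<..<?R} then v x $ a $ b else 0) absolutely_integrable_on UNIV"
      by (simp only: absolutely_integrable_restrict_UNIV)
    then show "(\<lambda>x. if x \<in> {0<..<?R} then v x $ a $ b else 0) absolutely_integrable_on {s..t}"
      by (rule set_integrable_subset) auto
    show "negligible {0 :: real}" by simp
    fix x assume "x \<in> {s..t} - {0}"
    then show "Vpot v x $ Inl a $ Inr b = (if x \<in> {0<..<?R} then v x $ a $ b else 0)"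
      by auto
  qed
  have 2: "(\<lambda>x. Vpot v x $ Inr b $ Inl a) absolutely_integrable_on {s..t}" for a b
  proof -
    have "(\<lambda>x. cnj (Vpot v x $ Inl a $ Inr b)) absolutely_integrable_on {s..t}"
      using absolutely_integrable_linear[OF 1 bounded_linear_cnj] by (simp add: o_def)
    moreover have "cnj (Vpot v x $ Inl a $ Inr b) = Vpot v x $ Inr b $ Inl a" for x
      by simp
    ultimately show ?thesis by simp
  qed
  show ?thesis
  proof (intro absint_vec)
    fix i j show "(\<lambda>x. Vpot v x $ i $ j) absolutely_integrable_on {s..t}"
      using 1 2 by (cases i; cases j) (simp_all del: Vpot_nth(3,4))
  qed
qed

lemma dirac_potential_absint: "(\<lambda>x. cmat \<i> (Jmat ** Vpot v x)) absolutely_integrable_on {s..t}"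
  using absolutely_integrable_linear[OF Vpot_absint bounded_linear_compose[OF bounded_linear_cmat
        bounded_bilinear.bounded_linear_right[OF bounded_bilinear_matrix_mult]], of s t \<i> Jmat]
  by (simp add: o_def)

lemma dirac_coef_absint: "dirac_coef v z absolutely_integrable_on {s..t}"
  unfolding dirac_coef_affine
  by (intro set_integral_add dirac_potential_absint absolutely_integrable_continuous_real) simp

lemma fund_sol_eq_fundamental: "fund_sol v l z = fundamental (dirac_coef v z) l"
  unfolding fund_sol_def
proof (rule the_equality)
  note F = fundamental_ac[OF dirac_coef_absint, of z l]
  show "is_fund_sol v l z (fundamental (dirac_coef v z) l)"
    by (simp add: is_fund_sol_iff dirac_coef_absint F fundamental_self)
  fix u assume "is_fund_sol v l z u"
  then have "u l = mat 1 \<and> ac_deriv u (\<lambda>t. dirac_coef v z t ** u t)"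
    by (simp add: is_fund_sol_iff dirac_coef_absint)
  then show "u = fundamental (dirac_coef v z) l"
    using ac_linear_unique[OF bounded_bilinear_matrix_mult dirac_coef_absint _ F, of u l]
    by (simp add: fundamental_self)
qed

lemma fund_sol_self: "fund_sol v l z l = mat 1"
  by (simp add: fund_sol_eq_fundamental fundamental_self)

lemma fund_sol_ac: "ac_deriv (fund_sol v l z) (\<lambda>t. dirac_coef v z t ** fund_sol v l z t)"
  by (simp add: fund_sol_eq_fundamental fundamental_ac dirac_coef_absint)

lemma fund_sol_holomorphic: "(\<lambda>z. fund_sol v l z x $ i $ j) holomorphic_on UNIV"
  using fundamental_holomorphic[OF dirac_potential_absint, of "cmat \<i> Jmat" l x i j]
  unfolding fund_sol_eq_fundamental by (simp add: dirac_coef_affine[abs_def])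

text \<open>Both sides solve the same system in x and agree at x = c. Taking x = l shows that
  \<open>fund_sol v c z l\<close> is a left inverse of \<open>fund_sol v l z c\<close>.\<close>

lemma fund_sol_mult: "fund_sol v c z x ** fund_sol v l z c = fund_sol v l z x"
proof -
  have "ac_deriv (\<lambda>x. fund_sol v c z x ** fund_sol v l z c)
      (\<lambda>t. dirac_coef v z t ** (fund_sol v c z t ** fund_sol v l z c))"
    using ac_deriv_rmult[OF fund_sol_ac] by (simp add: matrix_mul_assoc)
  from ac_linear_unique[OF bounded_bilinear_matrix_mult dirac_coef_absint this fund_sol_ac[of l], of c]
  have "(\<lambda>x. fund_sol v c z x ** fund_sol v l z c) = fund_sol v l z"
    by (simp add: fund_sol_self)
  then show ?thesis by (rule fun_cong)
qed

lemma fund_sol_vec_continuous: "continuous_on S (\<lambda>x. fund_sol v l z x *v c)"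
  by (rule ac_deriv_continuous[OF ac_deriv_rmult_vec[OF fund_sol_ac]])

lemma fund_sol_energy:
  fixes c :: "complex^('a + 'b)" and z :: complex and l :: real
  defines "y \<equiv> \<lambda>x. fund_sol v l z x *v c"
  shows "ac_deriv (\<lambda>x. kform (y x) (y x)) (\<lambda>x. - 2 * Im z * (norm (y x))\<^sup>2)"
proof -
  have "ac_deriv y (\<lambda>x. dirac_coef v z x *v y x)"
    unfolding y_def using ac_deriv_rmult_vec[OF fund_sol_ac] by (simp add: matrix_vector_mul_assoc)
  from ac_deriv_mult[OF bounded_bilinear_kform this this] show ?thesis
    by (simp add: kform_dirac_coef)
qed

end

section \<open>Square-integrable solutions\<close>

lemma square_integrable_bound:
  fixes g :: "real \<Rightarrow> 'e::euclidean_space"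
  assumes "continuous_on UNIV g" "h integrable_on {l<..}" "\<And>x. (norm (g x))\<^sup>2 \<le> h x"
  shows "(\<lambda>x. (norm (g x))\<^sup>2) integrable_on {l<..}"
proof (rule measurable_bounded_by_integrable_imp_integrable[OF _ assms(2)])
  show "(\<lambda>x. (norm (g x))\<^sup>2) \<in> borel_measurable (lebesgue_on {l<..})"
    by (intro continuous_imp_measurable_on_sets_lebesgue continuous_intros
        continuous_on_subset[OF assms(1)]) auto
qed (use assms(3) in auto)

lemma square_integrable_linear:
  fixes g :: "real \<Rightarrow> 'e::euclidean_space" and L :: "'e \<Rightarrow> 'f::euclidean_space"
  assumes L: "bounded_linear L" and g: "continuous_on UNIV g" "(\<lambda>x. (norm (g x))\<^sup>2) integrable_on {l<..}"
  shows "(\<lambda>x. (norm (L (g x)))\<^sup>2) integrable_on {l<..}"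
proof -
  obtain K where K: "\<And>x. norm (L x) \<le> norm x * K"
    using bounded_linear.bounded[OF L] by blast
  show ?thesis
  proof (rule square_integrable_bound)
    show "continuous_on UNIV (\<lambda>x. L (g x))"
      by (rule bounded_linear.continuous_on[OF L g(1)])
    show "(\<lambda>x. K\<^sup>2 * (norm (g x))\<^sup>2) integrable_on {l<..}"
      by (rule integrable_on_mult_right[OF g(2)])
    show "(norm (L (g x)))\<^sup>2 \<le> K\<^sup>2 * (norm (g x))\<^sup>2" for x
      using power_mono[OF K[of "g x"] norm_ge_zero, of 2] by (simp add: power_mult_distrib mult.commute)
  qed
qed

lemma square_integrable_diff:
  fixes f g :: "real \<Rightarrow> 'e::euclidean_space"
  assumes "continuous_on UNIV f" "(\<lambda>x. (norm (f x))\<^sup>2) integrable_on {l<..}"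
    and "continuous_on UNIV g" "(\<lambda>x. (norm (g x))\<^sup>2) integrable_on {l<..}"
  shows "(\<lambda>x. (norm (f x - g x))\<^sup>2) integrable_on {l<..}"
proof (rule square_integrable_bound)
  show "(\<lambda>x. 2 * (norm (f x))\<^sup>2 + 2 * (norm (g x))\<^sup>2) integrable_on {l<..}"
    by (intro integrable_add integrable_on_mult_right assms)
  show "(norm (f x - g x))\<^sup>2 \<le> 2 * (norm (f x))\<^sup>2 + 2 * (norm (g x))\<^sup>2" for x
  proof -
    have "(norm (f x - g x))\<^sup>2 + (norm (f x + g x))\<^sup>2 = 2 * (norm (f x))\<^sup>2 + 2 * (norm (g x))\<^sup>2"
      by (simp add: power2_norm_eq_inner inner_add inner_diff algebra_simps)
    then show ?thesis using zero_le_power2[of "norm (f x + g x)"] by linarith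
  qed
qed (intro continuous_intros assms)

lemma square_integrable_of_bounded_integrals:
  fixes g :: "real \<Rightarrow> 'e::euclidean_space"
  assumes g: "continuous_on UNIV g"
    and le: "\<And>T. l \<le> T \<Longrightarrow> integral {l..T} (\<lambda>x. (norm (g x))\<^sup>2) \<le> C"
  shows "(\<lambda>x. (norm (g x))\<^sup>2) integrable_on {l<..}"
proof -
  let ?h = "\<lambda>x. (norm (g x))\<^sup>2"
  define f where "f k x = (if x \<in> {l..l + real k} then ?h x else 0)" for k x
  have int: "?h integrable_on {s..t}" for s t
    by (intro integrable_continuous_interval continuous_intros continuous_on_subset[OF g]) simp
  have eq: "{l..l + real k} \<inter> {l..} = {l..l + real k}" for k by auto
  have "?h integrable_on {l..} \<and> (\<lambda>k. integral {l..} (f k)) \<longlonglongrightarrow> integral {l..} ?h"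
  proof (rule monotone_convergence_increasing)
    show "f k integrable_on {l..}" for k
      unfolding f_def integrable_restrict_Int eq by (rule int)
    show "f k x \<le> f (Suc k) x" for k x by (auto simp: f_def)
    show "(\<lambda>k. f k x) \<longlonglongrightarrow> ?h x" if "x \<in> {l..}" for x
    proof (rule tendsto_eventually)
      obtain n :: nat where "x - l \<le> real n" using real_arch_simple by blast
      then show "eventually (\<lambda>k. f k x = ?h x) sequentially"
        using that by (auto simp: eventually_sequentially f_def intro!: exI[of _ n])
    qed
    have "integral {l..} (f k) = integral {l..l + real k} ?h" for k
      unfolding f_def integral_restrict_Int eq ..
    moreover have "0 \<le> integral {l..l + real k} ?h" for k
      by (rule integral_nonneg[OF int]) simp
    ultimately show "bounded (range (\<lambda>k. integral {l..} (f k)))"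
      unfolding bounded_iff using le by (intro exI[of _ C]) auto
  qed
  then show ?thesis
    by (rule conjunct1[THEN integrable_spike_set]) (auto intro: negligible_subset[of "{l}"])
qed

section \<open>Columns, blocks and inverses of matrices\<close>

lemma matrix_mult_axis_nth: "(M *v axis k 1) $ i = (M :: complex^'n^'m) $ i $ k"
  by (simp add: matrix_vector_mult_def axis_def if_distrib if_distribR cong: if_cong)

lemma power2_norm_matrix:
  fixes M :: "complex^'n^'m"
  shows "(norm M)\<^sup>2 = (\<Sum>k\<in>UNIV. (norm (M *v axis k 1))\<^sup>2)"
  unfolding power2_norm_vec matrix_mult_axis_nth by (rule sum.swap)

lemma stack_id_mult_nth [simp]:
  "(stack_id \<phi> *v d) $ Inl a = d $ a" "(stack_id \<phi> *v d) $ Inr b = (\<phi> *v d) $ b"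
  by (simp_all add: stack_id_def matrix_vector_mult_def if_distrib if_distribR cong: if_cong)

text \<open>Exhibits the denominator and the numerator of the linear fractional transformation as
  the two blocks of \<open>W ** stack_id \<phi>\<close>.\<close>

lemma mult_stack_id_blocks:
  fixes W :: "complex^('a::finite + 'b::finite)^('a + 'b)"
  shows "(W *v (stack_id \<phi> *v d)) $ Inl a = ((blk11 W + blk12 W ** \<phi>) *v d) $ a"
    and "(W *v (stack_id \<phi> *v d)) $ Inr b = ((blk21 W + blk22 W ** \<phi>) *v d) $ b"
proof -
  have "(blk11 W *v p) $ a = (\<Sum>i\<in>UNIV. W $ Inl a $ Inl i * p $ i)"
    "(blk12 W *v q) $ a = (\<Sum>i\<in>UNIV. W $ Inl a $ Inr i * q $ i)"
    "(blk21 W *v p) $ b = (\<Sum>i\<in>UNIV. W $ Inr b $ Inl i * p $ i)"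
    "(blk22 W *v q) $ b = (\<Sum>i\<in>UNIV. W $ Inr b $ Inr i * q $ i)" for p q
    by (simp_all add: matrix_vector_mult_def blk11_def blk12_def blk21_def blk22_def)
  moreover have "(W *v y) $ i = (\<Sum>a\<in>UNIV. W $ i $ Inl a * y $ Inl a) + (\<Sum>b\<in>UNIV. W $ i $ Inr b * y $ Inr b)" for i y
    by (simp add: matrix_vector_mult_def sum_UNIV_plus)
  ultimately show "(W *v (stack_id \<phi> *v d)) $ Inl a = ((blk11 W + blk12 W ** \<phi>) *v d) $ a"
    and "(W *v (stack_id \<phi> *v d)) $ Inr b = ((blk21 W + blk22 W ** \<phi>) *v d) $ b"
    by (simp_all add: matrix_vector_mult_add_rdistrib matrix_vector_mul_assoc[symmetric])
qed

lemma invertible_iff_ker: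
  fixes A :: "complex^'n^'n"
  shows "invertible A \<longleftrightarrow> (\<forall>d. A *v d = 0 \<longrightarrow> d = 0)"
  by (simp add: invertible_left_inverse matrix_left_invertible_ker)

lemma matrix_inv_mult:
  fixes A :: "complex^'n^'n"
  assumes "invertible A"
  shows "A ** matrix_inv A = mat 1" "matrix_inv A ** A = mat 1"
  using someI_ex[OF assms[unfolded invertible_def]] by (auto simp: matrix_inv_def)

lemma holomorphic_det:
  fixes M :: "complex \<Rightarrow> complex^'n^'n"
  assumes "\<And>i j. (\<lambda>z. M z $ i $ j) holomorphic_on S"
  shows "(\<lambda>z. det (M z)) holomorphic_on S"
  unfolding det_def by (intro holomorphic_intros assms)

text \<open>By Cramer's rule each entry of the inverse is a quotient of determinants, and these are
  polynomials in the entries.\<close>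

lemma holomorphic_matrix_inv:
  fixes M :: "complex \<Rightarrow> complex^'n^'n"
  assumes M: "\<And>i j. (\<lambda>z. M z $ i $ j) holomorphic_on S"
    and inv: "\<And>z. z \<in> S \<Longrightarrow> invertible (M z)"
  shows "(\<lambda>z. matrix_inv (M z) $ i $ j) holomorphic_on S"
proof -
  have det: "det (M z) \<noteq> 0" if "z \<in> S" for z
    using inv[OF that] by (simp add: invertible_det_nz)
  have eq: "det (\<chi> p q. if q = i then axis j 1 $ p else M z $ p $ q) / det (M z) = matrix_inv (M z) $ i $ j"
    if "z \<in> S" for z
  proof -
    have "M z *v (matrix_inv (M z) *v axis j 1) = axis j 1"
      by (simp add: matrix_vector_mul_assoc matrix_inv_mult inv[OF that])
    then have "matrix_inv (M z) *v axis j 1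
        = (\<chi> k. det (\<chi> p q. if q = k then axis j 1 $ p else M z $ p $ q) / det (M z))"
      by (simp only: cramer[OF det[OF that]])
    then show ?thesis by (simp add: vec_eq_iff matrix_mult_axis_nth)
  qed
  have "(\<lambda>z. (\<chi> p q. if q = i then axis j 1 $ p else M z $ p $ q) $ p $ q) holomorphic_on S" for p q
    by (cases "q = i") (use M in auto)
  then have "(\<lambda>z. det (\<chi> p q. if q = i then axis j 1 $ p else M z $ p $ q) / det (M z)) holomorphic_on S"
    using det M by (intro holomorphic_intros holomorphic_det)
  then show ?thesis by (rule holomorphic_transform) (rule eq)
qed

section \<open>The Weyl condition at a fixed z\<close>

context dirac_system
begin

text \<open>The square-integrability clause of \<open>is_WT\<close> for a single z, detached from
  holomorphy, since uniqueness and change of endpoint hold for each z separately.\<close>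

definition weyl :: "real \<Rightarrow> complex \<Rightarrow> complex^'a^'b \<Rightarrow> bool" where
  "weyl l z \<phi> \<longleftrightarrow> (\<lambda>x. (norm (fund_sol v l z x ** stack_id \<phi>))\<^sup>2) integrable_on {l<..}"

lemma fund_sol_continuous: "continuous_on S (\<lambda>x. fund_sol v l z x ** N)"
  by (rule ac_deriv_continuous[OF ac_deriv_rmult[OF fund_sol_ac]])

lemma weyl_iff_entries:
  "weyl l z \<phi> \<longleftrightarrow> (\<forall>i k.
      (\<lambda>x. (fund_sol v l z x ** stack_id \<phi>) $ i $ k) \<in> borel_measurable (lebesgue_on {l<..}) \<and>
      (\<lambda>x. (cmod ((fund_sol v l z x ** stack_id \<phi>) $ i $ k))\<^sup>2) integrable_on {l<..})"
proof -
  let ?M = "\<lambda>x. fund_sol v l z x ** stack_id \<phi>"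
  have L: "bounded_linear (\<lambda>M :: complex^'a^('a + 'b). M $ i $ k)" for i k
    by (rule bounded_linear_compose[OF bounded_linear_vec_nth bounded_linear_vec_nth])
  have "(\<lambda>x. ?M x $ i $ k) \<in> borel_measurable (lebesgue_on {l<..})" for i k
    by (intro continuous_imp_measurable_on_sets_lebesgue bounded_linear.continuous_on[OF L] fund_sol_continuous) auto
  moreover have "(\<lambda>x. (cmod (?M x $ i $ k))\<^sup>2) integrable_on {l<..}" if "weyl l z \<phi>" for i k
    using that unfolding weyl_def by (rule square_integrable_linear[OF L fund_sol_continuous])
  moreover have "weyl l z \<phi>" if "\<And>i k. (\<lambda>x. (cmod (?M x $ i $ k))\<^sup>2) integrable_on {l<..}"
    unfolding weyl_def power2_norm_vec using that by (intro integrable_sum) auto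
  ultimately show ?thesis by blast
qed

lemma is_WT_iff:
  "is_WT v l \<phi> \<longleftrightarrow> (\<forall>b k. (\<lambda>z. \<phi> z $ b $ k) holomorphic_on {z. Im z > 0}) \<and>
     (\<forall>z. Im z > 0 \<longrightarrow> weyl l z (\<phi> z)) \<and> (\<forall>z. Im z \<le> 0 \<longrightarrow> \<phi> z = 0)"
  unfolding is_WT_def weyl_iff_entries ..

lemma kform_antimono:
  assumes "Im z > 0" "s \<le> t"
  shows "kform (fund_sol v l z t *v c) (fund_sol v l z t *v c) \<le> kform (fund_sol v l z s *v c) (fund_sol v l z s *v c)"
proof -
  have "integral {s..t} (\<lambda>x. 2 * Im z * (norm (fund_sol v l z x *v c))\<^sup>2) \<ge> 0"
    using assms by (intro integral_nonneg integrable_continuous_interval continuous_intros fund_sol_vec_continuous) auto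
  then show ?thesis
    using ac_deriv_incr[OF fund_sol_energy assms(2), of l z c] by simp
qed

lemma kform_nonneg_if_square_integrable:
  assumes z: "Im z > 0" and "l \<le> s"
    and int: "(\<lambda>x. (norm (fund_sol v c z x *v d))\<^sup>2) integrable_on {l<..}"
  shows "kform (fund_sol v c z s *v d) (fund_sol v c z s *v d) \<ge> 0"
proof (rule ccontr)
  let ?y = "\<lambda>x. fund_sol v c z x *v d"
  define e where "e = - kform (?y s) (?y s)"
  define I where "I = integral {l<..} (\<lambda>x. (norm (?y x))\<^sup>2)"
  assume "\<not> ?thesis"
  then have e: "e > 0" by (simp add: e_def)
  have I: "I \<ge> 0" unfolding I_def by (intro integral_nonneg int) simp
  \<comment> \<open>Over a length of \<open>(I + 1) / e\<close> the lower bound e integrates to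
    \<open>I + 1\<close>, more than the whole integral. Starting at \<open>s + 1\<close> keeps the
    interval inside the open half-line.\<close>
  define T where "T = s + 1 + (I + 1) / e"
  have T: "s + 1 \<le> T" using e I by (simp add: T_def)
  have low: "e \<le> (norm (?y x))\<^sup>2" if "s \<le> x" for x
    using kform_antimono[OF z that, of c d] abs_kform_le[of "?y x"] by (simp add: e_def)
  have i: "(\<lambda>x. (norm (?y x))\<^sup>2) integrable_on {s+1..T}"
    by (intro integrable_continuous_interval continuous_intros fund_sol_vec_continuous)
  have "integral {s+1..T} (\<lambda>x. e) \<le> integral {s+1..T} (\<lambda>x. (norm (?y x))\<^sup>2)"
    by (intro integral_le i low) auto
  also have "\<dots> \<le> I"
    unfolding I_def by (rule integral_subset_le) (use \<open>l \<le> s\<close> i int in auto)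
  also have "integral {s+1..T} (\<lambda>x. e) = I + 1"
    using T e by (simp add: T_def)
  finally show False by simp
qed

lemma weyl_square_integrable:
  assumes "weyl l z \<phi>"
  shows "(\<lambda>x. (norm (fund_sol v l z x *v (stack_id \<phi> *v d)))\<^sup>2) integrable_on {l<..}"
  using square_integrable_linear[OF bounded_bilinear.bounded_linear_left[OF bounded_bilinear_matrix_vector_mult, of d]
    fund_sol_continuous assms[unfolded weyl_def]]
  by (simp add: matrix_vector_mul_assoc)

lemma weyl_unique:
  assumes z: "Im z > 0" and \<phi>: "weyl l z \<phi>" and \<psi>: "weyl l z \<psi>"
  shows "\<phi> = \<psi>"
proof -
  have "\<phi> *v d = \<psi> *v d" for d
  proof -
    \<comment> \<open>The upper blocks, both equal to d, cancel; so \<open>kform c c\<close> is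
      minus the squared norm of the difference sought.\<close>
    define c where "c = stack_id \<phi> *v d - stack_id \<psi> *v d"
    have "(\<lambda>x. (norm (fund_sol v l z x *v c))\<^sup>2) integrable_on {l<..}"
      unfolding c_def matrix_vector_mult_diff_distrib
      by (intro square_integrable_diff fund_sol_vec_continuous weyl_square_integrable \<phi> \<psi>)
    from kform_nonneg_if_square_integrable[OF z order_refl this]
    have "kform c c \<ge> 0" by (simp add: fund_sol_self)
    then have "(\<Sum>b\<in>UNIV. (norm ((\<phi> *v d) $ b - (\<psi> *v d) $ b))\<^sup>2) \<le> 0"
      by (simp add: kform_self c_def)
    then have "(\<Sum>b\<in>UNIV. (norm ((\<phi> *v d) $ b - (\<psi> *v d) $ b))\<^sup>2) = 0"
      by (intro antisym sum_nonneg) auto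
    then show ?thesis by (simp add: sum_nonneg_eq_0_iff vec_eq_iff)
  qed
  then show ?thesis by (simp add: matrix_eq)
qed

text \<open>By the energy identity \<open>2 * Im z\<close> times the integral of the squared norm is
  the drop of the form, which cannot exceed its value at l as long as the form stays
  nonnegative.\<close>

lemma weyl_if_kform_nonneg:
  assumes z: "Im z > 0"
    and nonneg: "\<And>x d. l \<le> x \<Longrightarrow>
      kform (fund_sol v l z x *v (stack_id \<phi> *v d)) (fund_sol v l z x *v (stack_id \<phi> *v d)) \<ge> 0"
  shows "weyl l z \<phi>"
proof -
  have "(\<lambda>x. (norm (fund_sol v l z x *v (stack_id \<phi> *v d)))\<^sup>2) integrable_on {l<..}" for d
  proof (rule square_integrable_of_bounded_integrals[OF fund_sol_vec_continuous])
    let ?y = "\<lambda>x. fund_sol v l z x *v (stack_id \<phi> *v d)"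
    fix T assume T: "l \<le> T"
    have "2 * Im z * integral {l..T} (\<lambda>x. (norm (?y x))\<^sup>2) = kform (?y l) (?y l) - kform (?y T) (?y T)"
      using ac_deriv_incr[OF fund_sol_energy T, of l z "stack_id \<phi> *v d"] by simp
    also have "\<dots> \<le> kform (?y l) (?y l)" using nonneg[OF T] by simp
    finally show "integral {l..T} (\<lambda>x. (norm (?y x))\<^sup>2) \<le> kform (?y l) (?y l) / (2 * Im z)"
      using z by (simp add: field_simps)
  qed
  then show ?thesis
    unfolding weyl_def power2_norm_matrix by (intro integrable_sum) (auto simp: matrix_vector_mul_assoc)
qed

end

section \<open>Existence of the Weyl--Titchmarsh function\<close>

context dirac_system
begin

text \<open>With \<open>u\<^sub>R(l) = u\<^sub>l(R)\<^sup>-\<^sup>1\<close>, this is the \<open>\<phi>\<close> for which the lower block of \<open>u\<^sub>l(R) [I; \<phi>]\<close> vanishes.\<close>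
definition weyl_approx :: "real \<Rightarrow> real \<Rightarrow> complex \<Rightarrow> complex^'a^'b" where
  "weyl_approx l R z = blk21 (fund_sol v R z l) ** matrix_inv (blk11 (fund_sol v R z l))"

lemma kform_stack_id_0: "kform (stack_id 0 *v c) (stack_id 0 *v c) = (norm c)\<^sup>2"
  by (simp add: kform_self power2_norm_vec)

text \<open>Going left from R the form can only grow, starting from the value
  \<open>(norm d)\<^sup>2\<close> of the data [d; 0]. A vanishing upper block at l would make it
  nonpositive there.\<close>

lemma invertible_blk11_backward:
  assumes z: "Im z > 0" and "l \<le> R"
  shows "invertible (blk11 (fund_sol v R z l))"
  unfolding invertible_iff_ker
proof (intro allI impI)
  fix d assume d: "blk11 (fund_sol v R z l) *v d = 0"
  let ?y = "fund_sol v R z l *v (stack_id 0 *v d)"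
  have "(norm d)\<^sup>2 \<le> kform ?y ?y"
    using kform_antimono[OF assms, of R "stack_id 0 *v d"]
    by (simp add: fund_sol_self kform_stack_id_0)
  also have "\<dots> \<le> 0"
    using d by (simp add: kform_self mult_stack_id_blocks sum_nonneg)
  finally show "d = 0" by simp
qed

lemma weyl_approx_kform_nonneg:
  assumes z: "Im z > 0" and "l \<le> R" "x \<le> R"
  shows "kform (fund_sol v l z x *v (stack_id (weyl_approx l R z) *v d))
               (fund_sol v l z x *v (stack_id (weyl_approx l R z) *v d)) \<ge> 0"
proof -
  let ?W = "fund_sol v R z l" and ?\<phi> = "weyl_approx l R z"
  note inv = matrix_inv_mult[OF invertible_blk11_backward[OF z \<open>l \<le> R\<close>]]
  \<comment> \<open>The upper block at R: the solution starting from
    \<open>stack_id (weyl_approx l R z) *v d\<close> at l is the one with data [c; 0] at R, where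
    the form equals \<open>(norm c)\<^sup>2\<close>.\<close>
  define c where "c = matrix_inv (blk11 ?W) *v d"
  have "?W *v (stack_id 0 *v c) = stack_id ?\<phi> *v d"
    unfolding vec_eq_iff
  proof
    fix i show "(?W *v (stack_id 0 *v c)) $ i = (stack_id ?\<phi> *v d) $ i"
      by (cases i) (simp_all add: mult_stack_id_blocks,
        simp_all add: c_def weyl_approx_def matrix_vector_mul_assoc inv)
  qed
  then have "fund_sol v l z x *v (stack_id ?\<phi> *v d) = fund_sol v R z x *v (stack_id 0 *v c)"
    by (metis fund_sol_mult matrix_vector_mul_assoc)
  then show ?thesis
    using kform_antimono[OF z \<open>x \<le> R\<close>, of R "stack_id 0 *v c"]
      order.trans[OF zero_le_power2[of "norm c"]]
    by (simp add: fund_sol_self kform_stack_id_0)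
qed

text \<open>At x = l nonnegativity of the form says that \<phi> is a contraction. The entrywise
  bound, uniform in R and z, is what makes the family normal.\<close>

lemma norm_weyl_approx_le:
  assumes z: "Im z > 0" and "l \<le> R"
  shows "norm (weyl_approx l R z $ b $ k) \<le> 1"
proof -
  let ?\<phi> = "weyl_approx l R z" and ?d = "axis k 1 :: complex^'a"
  have "kform (stack_id ?\<phi> *v ?d) (stack_id ?\<phi> *v ?d) \<ge> 0"
    using weyl_approx_kform_nonneg[OF assms \<open>l \<le> R\<close>, of ?d] by (simp add: fund_sol_self)
  then have "(norm (?\<phi> *v ?d))\<^sup>2 \<le> (norm ?d)\<^sup>2"
    unfolding kform_self stack_id_mult_nth power2_norm_vec[symmetric] by simp
  then have "norm (?\<phi> *v ?d) \<le> norm ?d"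
    by (rule power2_le_imp_le) simp
  then have "norm (?\<phi> *v ?d) \<le> 1"
    by (simp add: norm_axis_1)
  then show ?thesis
    using Finite_Cartesian_Product.norm_nth_le[of "?\<phi> *v ?d" b] by (simp add: matrix_mult_axis_nth)
qed

lemma weyl_approx_holomorphic:
  assumes "l \<le> R"
  shows "(\<lambda>z. weyl_approx l R z $ b $ k) holomorphic_on {z. Im z > 0}"
proof -
  have "(\<lambda>z. matrix_inv (blk11 (fund_sol v R z l)) $ i $ j) holomorphic_on {z. Im z > 0}" for i j
    using invertible_blk11_backward[OF _ assms]
    by (intro holomorphic_matrix_inv)
      (auto simp: blk11_def intro: holomorphic_on_subset[OF fund_sol_holomorphic])
  moreover have "(\<lambda>z. blk21 (fund_sol v R z l) $ i $ j) holomorphic_on {z. Im z > 0}" for i j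
    by (auto simp: blk21_def intro: holomorphic_on_subset[OF fund_sol_holomorphic])
  ultimately show ?thesis
    unfolding weyl_approx_def matrix_matrix_mult_def by (auto intro!: holomorphic_intros)
qed

text \<open>Each fixed x is eventually below \<open>r n\<close>, so nonnegativity of the form at x
  survives the limit.\<close>

lemma weyl_limit:
  assumes z: "Im z > 0" and r: "filterlim r at_top sequentially"
    and lim: "(\<lambda>n. weyl_approx l (r n) z) \<longlonglongrightarrow> \<phi>"
  shows "weyl l z \<phi>"
proof (rule weyl_if_kform_nonneg[OF z])
  fix x d assume "l \<le> x"
  have stack: "(\<lambda>n. stack_id (weyl_approx l (r n) z) *v d) \<longlonglongrightarrow> stack_id \<phi> *v d"
  proof (rule vec_tendstoI)
    have "(\<lambda>n. (weyl_approx l (r n) z *v d) $ b) \<longlonglongrightarrow> (\<phi> *v d) $ b" for b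
      by (intro tendsto_intros bounded_bilinear.tendsto[OF bounded_bilinear_matrix_vector_mult] lim)
    then show "(\<lambda>n. (stack_id (weyl_approx l (r n) z) *v d) $ i) \<longlonglongrightarrow> (stack_id \<phi> *v d) $ i" for i
      by (cases i) auto
  qed
  note y = bounded_bilinear.tendsto[OF bounded_bilinear_matrix_vector_mult tendsto_const[of "fund_sol v l z x"] stack]
  have "eventually (\<lambda>n. x \<le> r n) sequentially"
    using r by (simp add: filterlim_at_top)
  then show "0 \<le> kform (fund_sol v l z x *v (stack_id \<phi> *v d)) (fund_sol v l z x *v (stack_id \<phi> *v d))"
    using \<open>l \<le> x\<close>
    by (intro tendsto_lowerbound[OF bounded_bilinear.tendsto[OF bounded_bilinear_kform y y]])
      (auto elim!: eventually_mono intro!: weyl_approx_kform_nonneg[OF z])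
qed

text \<open>It starts from an arbitrary \<open>r\<close> so that it can refine the subsequence which
  Montel's theorem has already selected.\<close>

lemma weyl_subsequence:
  assumes z: "Im z > 0" and r: "strict_mono (r :: nat \<Rightarrow> nat)"
  obtains s \<phi> where "strict_mono (s :: nat \<Rightarrow> nat)" "weyl l z \<phi>"
    "(\<lambda>n. weyl_approx l (l + real (r (s n))) z) \<longlonglongrightarrow> \<phi>"
proof -
  have "norm (weyl_approx l (l + real (r n)) z) \<le> (\<Sum>b\<in>(UNIV :: 'b set). \<Sum>k\<in>(UNIV :: 'a set). 1)" for n
    by (rule order.trans[OF norm_le_sum_entries]) (intro sum_mono norm_weyl_approx_le[OF z], simp)
  then have "bounded (range (\<lambda>n. weyl_approx l (l + real (r n)) z))"
    unfolding bounded_iff by blast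
  then obtain \<phi> s where s: "strict_mono (s :: nat \<Rightarrow> nat)"
    and lim: "((\<lambda>n. weyl_approx l (l + real (r n)) z) \<circ> s) \<longlonglongrightarrow> \<phi>"
    using bounded_imp_convergent_subsequence by blast
  have "filterlim (\<lambda>n. r (s n)) at_top sequentially"
    using filterlim_subseq[OF strict_mono_o[OF r s]] by (simp add: o_def)
  then have "filterlim (\<lambda>n. real (r (s n))) at_top sequentially"
    by (rule filterlim_compose[OF filterlim_real_sequentially])
  then have "filterlim (\<lambda>n. l + real (r (s n))) at_top sequentially"
    by (rule filterlim_tendsto_add_at_top[OF tendsto_const])
  from weyl_limit[OF z this] lim s show thesis
    by (intro that[of s \<phi>]) (auto simp: o_def)
qed

lemma ex_WT: "\<exists>\<phi>. is_WT v l \<phi>"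
proof -
  \<comment> \<open>Chosen for each z independently, with no regularity; the value 0 outside the
    upper half-plane is the normalisation in \<open>is_WT\<close>.\<close>
  define \<Phi> where "\<Phi> z = (if Im z > 0 then SOME \<phi>. weyl l z \<phi> else 0)" for z
  have \<Phi>: "weyl l z (\<Phi> z)" if "Im z > 0" for z
  proof -
    have "\<exists>\<phi>. weyl l z \<phi>"
      using weyl_subsequence[OF that strict_mono_id, of l] by blast
    then show ?thesis using that by (simp add: \<Phi>_def someI_ex)
  qed
  have "(\<lambda>z. \<Phi> z $ b $ k) holomorphic_on {z. Im z > 0}" for b k
  proof -
    let ?S = "{z. Im z > 0}"
    let ?H = "{h. h holomorphic_on ?S \<and> (\<forall>z\<in>?S. norm (h z) \<le> 1)}"
    let ?F = "\<lambda>n z. weyl_approx l (l + real n) z $ b $ k"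
    have F: "range ?F \<subseteq> ?H"
      using weyl_approx_holomorphic norm_weyl_approx_le by auto
    \<comment> \<open>Here \<open>r\<close> and \<open>g\<close> depend on the entry (b, k). This is
      harmless, since the limit is identified below with an entry of \<open>\<Phi>\<close>.\<close>
    obtain g r where g: "g holomorphic_on ?S" and r: "strict_mono (r :: nat \<Rightarrow> nat)"
      and lim: "\<And>z. z \<in> ?S \<Longrightarrow> (\<lambda>n. ?F (r n) z) \<longlonglongrightarrow> g z"
      by (rule Montel[of ?S ?H ?F]) (use F open_halfspace_Im_gt in \<open>auto 4 4\<close>)
    have "g z = \<Phi> z $ b $ k" if z: "z \<in> ?S" for z
    proof -
      from z have "Im z > 0" by simp
      then obtain s \<phi> where s: "strict_mono (s :: nat \<Rightarrow> nat)" and \<phi>: "weyl l z \<phi>"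
        and lim': "(\<lambda>n. weyl_approx l (l + real (r (s n))) z) \<longlonglongrightarrow> \<phi>"
        using weyl_subsequence[OF _ r] by metis
      have "\<phi> = \<Phi> z" by (rule weyl_unique[OF \<open>Im z > 0\<close> \<phi> \<Phi>[OF \<open>Im z > 0\<close>]])
      moreover have "(\<lambda>n. ?F (r (s n)) z) \<longlonglongrightarrow> \<phi> $ b $ k"
        by (intro tendsto_intros lim')
      moreover have "(\<lambda>n. ?F (r (s n)) z) \<longlonglongrightarrow> g z"
        using LIMSEQ_subseq_LIMSEQ[OF lim[OF z] s] by (simp add: o_def)
      ultimately show ?thesis using LIMSEQ_unique by blast
    qed
    then show ?thesis by (rule holomorphic_transform[OF g])
  qed
  then have "is_WT v l \<Phi>"
    unfolding is_WT_iff using \<Phi> by (auto simp: \<Phi>_def)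
  then show ?thesis by blast
qed

text \<open>Uniqueness at each z in the upper half-plane and the common value 0 elsewhere make any
  two candidates equal as functions, so the \<open>THE\<close> in \<open>WT\<close> denotes.\<close>

lemma weyl_WT:
  assumes "Im z > 0"
  shows "weyl l z (WT v l z)"
proof -
  obtain \<phi> where \<phi>: "is_WT v l \<phi>" using ex_WT by blast
  have "WT v l = \<phi>"
    unfolding WT_def
  proof (rule the_equality[where P = "is_WT v l", OF \<phi>], rule ext)
    fix \<psi> z assume "is_WT v l \<psi>"
    with \<phi> show "\<psi> z = \<phi> z"
      unfolding is_WT_iff by (cases "Im z > 0") (auto intro: weyl_unique)
  qed
  with \<phi> assms show ?thesis by (simp add: is_WT_iff)
qed

section \<open>Moving the left endpoint\<close>

lemma invertible_weyl_denominator: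
  assumes z: "Im z > 0" and "l \<le> s" and \<phi>: "weyl l z \<phi>"
  shows "invertible (blk11 (fund_sol v l z s) + blk12 (fund_sol v l z s) ** \<phi>)"
  unfolding invertible_iff_ker
proof (intro allI impI)
  let ?W = "fund_sol v l z s"
  fix d assume d: "(blk11 ?W + blk12 ?W ** \<phi>) *v d = 0"
  let ?y = "?W *v (stack_id \<phi> *v d)"
  have top: "?y $ Inl a = 0" for a by (simp add: mult_stack_id_blocks d)
  have "kform ?y ?y \<ge> 0"
    by (rule kform_nonneg_if_square_integrable[OF z \<open>l \<le> s\<close> weyl_square_integrable[OF \<phi>]])
  then have "(norm ?y)\<^sup>2 \<le> 0"
    unfolding power2_norm_vec sum_UNIV_plus kform_self by (simp add: top)
  then have "?y = 0" by simp
  \<comment> \<open>Propagating back from s to l undoes \<open>?W\<close> and recovers the initial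
    data, whose upper block is d.\<close>
  then have "fund_sol v s z l *v ?y = 0" by simp
  then have "stack_id \<phi> *v d = 0"
    by (simp only: matrix_vector_mul_assoc[of "fund_sol v s z l" ?W] fund_sol_mult fund_sol_self
        matrix_vector_mul_lid)
  then show "d = 0" by (metis stack_id_mult_nth(1) vec_eq_iff zero_index)
qed

text \<open>Right multiplication by the inverse of the upper block at s normalises the solution
  there to [I; *] without affecting square integrability.\<close>

lemma weyl_shift:
  assumes z: "Im z > 0" and "l \<le> s" and \<phi>: "weyl l z \<phi>"
  defines "W \<equiv> fund_sol v l z s"
  shows "weyl s z ((blk21 W + blk22 W ** \<phi>) ** matrix_inv (blk11 W + blk12 W ** \<phi>))"
proof -
  let ?X = "blk11 W + blk12 W ** \<phi>" and ?Y = "blk21 W + blk22 W ** \<phi>"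
  note inv = matrix_inv_mult[OF invertible_weyl_denominator[OF assms(1-3)], folded W_def]
  have "W ** stack_id \<phi> ** matrix_inv ?X = stack_id (?Y ** matrix_inv ?X)"
    unfolding matrix_eq vec_eq_iff
  proof (intro allI)
    fix d i show "((W ** stack_id \<phi> ** matrix_inv ?X) *v d) $ i = (stack_id (?Y ** matrix_inv ?X) *v d) $ i"
      by (cases i) (simp_all add: matrix_vector_mul_assoc[symmetric] mult_stack_id_blocks,
        simp_all add: matrix_vector_mul_assoc inv)
  qed
  then have eq: "fund_sol v s z x ** stack_id (?Y ** matrix_inv ?X)
      = fund_sol v l z x ** stack_id \<phi> ** matrix_inv ?X" for x
    using fund_sol_mult[of s z x l] by (metis W_def matrix_mul_assoc)
  have "(\<lambda>x. (norm (fund_sol v l z x ** stack_id \<phi> ** matrix_inv ?X))\<^sup>2) integrable_on {l<..}"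
    using \<phi> unfolding weyl_def
    by (rule square_integrable_linear[OF bounded_bilinear.bounded_linear_left[OF bounded_bilinear_matrix_mult] fund_sol_continuous])
  \<comment> \<open>The restriction to a smaller half-line goes through absolute integrability,
    available since the integrand is nonnegative.\<close>
  then have "(\<lambda>x. (norm (fund_sol v l z x ** stack_id \<phi> ** matrix_inv ?X))\<^sup>2) absolutely_integrable_on {l<..}"
    by (rule nonnegative_absolutely_integrable_1) simp
  then have "(\<lambda>x. (norm (fund_sol v l z x ** stack_id \<phi> ** matrix_inv ?X))\<^sup>2) absolutely_integrable_on {s<..}"
    by (rule set_integrable_subset) (use \<open>l \<le> s\<close> in auto)
  then show ?thesis
    unfolding weyl_def eq by (rule set_lebesgue_integral_eq_integral(1))
qed

end

theorem theorem2p1: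
  fixes v :: "real \<Rightarrow> complex^'b::finite^'a::finite"
    and l :: real and z :: complex
  assumes v_loc_L1: "\<forall>R>0. \<forall>a b. (\<lambda>x. v x $ a $ b) absolutely_integrable_on {0<..<R}"
    and l_nonneg: "l \<ge> 0"
    and z_upper: "Im z > 0"
  shows "invertible (blk11 (fund_sol v 0 z l) + blk12 (fund_sol v 0 z l) ** WT v 0 z) \<and>
         WT v l z = (blk21 (fund_sol v 0 z l) + blk22 (fund_sol v 0 z l) ** WT v 0 z)
                    ** matrix_inv (blk11 (fund_sol v 0 z l) + blk12 (fund_sol v 0 z l) ** WT v 0 z)"
proof -
  interpret dirac_system v by unfold_locales (rule v_loc_L1)
  note \<phi> = weyl_WT[OF z_upper]
  show ?thesis
    using invertible_weyl_denominator[OF z_upper l_nonneg \<phi>]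
      weyl_unique[OF z_upper \<phi> weyl_shift[OF z_upper l_nonneg \<phi>]] by blast
qed

end
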